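(* Every subexponential group $G$ has the comparison property.
   Context: "Countable" means infinite countable and discrete. A finitely generated group with a finite generator $R$ (i.e. $\bigcup_{n\ge1}(R\cup R^{-1})^n$ is the whole group) has *subexponential growth* if $\lim_{n\to\infty}\frac1n\log|(R\cup R^{-1})^n|=0$ (this does not depend on the finite generator). A countable group $G$ (not necessarily finitely generated) is *subexponential* if every finitely generated subgroup of $G$ has subexponential growth. Every subexponential group is amenable. *Comparison.* Let an amenable group $G$ act by homeomorphisms on a zero-dimensional compact metric space $X$. For clopen sets $\mathsf A,\mathsf B\subset X$, $\mathsf A$ is *subequivalent* to $\mathsf B$ (written $\mathsf A\preccurlyeq\mathsf B$) if there exist a finite partition $\mathsf A=\bigcup_{i=1}^k\mathsf A_i$ into clopen sets and elements $g_1,\dots,g_k\in G$ such that $g_1(\mathsf A_1),\dots,g_k(\mathsf A_k)$ are pairwise disjoint subsets of $\mathsf B$. The action *admits comparison* if for any clopen $\mathsf A,\mathsf B\subset X$, the condition $\mu(\mathsf A)<\mu(\mathsf B)$ for every $G$-invariant Borel probability measure $\mu$ on $X$ implies $\mathsf A\preccurlyeq\mathsf B$. $G$ has the *comparison property* if every action of $G$ on any zero-dimensional compact metric space admits comparison. *)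

theory Defs
  imports
    "HOL-Algebra.Group_Action"
    "HOL-Analysis.Analysis"
    "HOL-Probability.Probability_Measure"
begin

section \<open>Subexponential groups\<close>

primrec set_power :: "('g, 'm) monoid_scheme \<Rightarrow> 'g set \<Rightarrow> nat \<Rightarrow> 'g set" where
  "set_power G S 0 = {\<one>\<^bsub>G\<^esub>}"
| "set_power G S (Suc n) = set_power G S n <#>\<^bsub>G\<^esub> S"

definition sym_power :: "('g, 'm) monoid_scheme \<Rightarrow> 'g set \<Rightarrow> nat \<Rightarrow> 'g set" where
  "sym_power G R n = set_power G (R \<union> set_inv\<^bsub>G\<^esub> R) n"

definition finite_generator :: "('g, 'm) monoid_scheme \<Rightarrow> 'g set \<Rightarrow> bool" where
  "finite_generator G R \<longleftrightarrow>
     finite R \<and> R \<subseteq> carrier G \<and> (\<Union>n\<in>{1..}. sym_power G R n) = carrier G"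

text \<open>
  The growth condition does not depend on the finite generator. Since the notion is used
  as a hypothesis, the existential (formally weaker) reading is taken.
\<close>

definition subexponential_growth :: "('g, 'm) monoid_scheme \<Rightarrow> bool" where
  "subexponential_growth G \<longleftrightarrow>
     (\<exists>R. finite_generator G R \<and>
          (\<lambda>n. (1 / real n) * ln (real (card (sym_power G R n)))) \<longlonglongrightarrow> 0)"

text \<open>
  ``Countable'' means countably infinite. The topology on the group is discrete, so no
  continuity in the group variable is ever required.
\<close>

definition subexponential_group :: "('g, 'm) monoid_scheme \<Rightarrow> bool" where
  "subexponential_group G \<longleftrightarrow>
     group G \<and> countable (carrier G) \<and> infinite (carrier G) \<and>
     (\<forall>H. subgroup H G \<and> (\<exists>R. finite_generator (G\<lparr>carrier := H\<rparr>) R) \<longrightarrow>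
          subexponential_growth (G\<lparr>carrier := H\<rparr>))"


section \<open>Comparison\<close>

definition zero_dim_compact_metric_space :: "'x topology \<Rightarrow> bool" where
  "zero_dim_compact_metric_space X \<longleftrightarrow>
     metrizable_space X \<and> compact_space X \<and> X dim_le 0"

definition action_by_homeomorphisms ::
    "('g, 'm) monoid_scheme \<Rightarrow> 'x topology \<Rightarrow> ('g \<Rightarrow> 'x \<Rightarrow> 'x) \<Rightarrow> bool" where
  "action_by_homeomorphisms G X \<phi> \<longleftrightarrow>
     group_action G (topspace X) \<phi> \<and> (\<forall>g\<in>carrier G. homeomorphic_map X X (\<phi> g))"

definition clopen_in :: "'x topology \<Rightarrow> 'x set \<Rightarrow> bool" where
  "clopen_in X A \<longleftrightarrow> openin X A \<and> closedin X A"

definition invariant_borel_prob ::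
    "('g, 'm) monoid_scheme \<Rightarrow> 'x topology \<Rightarrow> ('g \<Rightarrow> 'x \<Rightarrow> 'x) \<Rightarrow> 'x measure \<Rightarrow> bool" where
  "invariant_borel_prob G X \<phi> \<mu> \<longleftrightarrow>
     prob_space \<mu> \<and> space \<mu> = topspace X \<and>
     sets \<mu> = sigma_sets (topspace X) {U. openin X U} \<and>
     (\<forall>g\<in>carrier G. \<forall>E\<in>sets \<mu>. measure \<mu> (\<phi> g ` E) = measure \<mu> E)"

text \<open>
  Some of the pieces \<open>P i\<close> may be empty; this makes no difference, since empty pieces can be
  dropped.
\<close>

definition subequivalent ::
    "('g, 'm) monoid_scheme \<Rightarrow> 'x topology \<Rightarrow> ('g \<Rightarrow> 'x \<Rightarrow> 'x) \<Rightarrow> 'x set \<Rightarrow> 'x set \<Rightarrow> bool" where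
  "subequivalent G X \<phi> A B \<longleftrightarrow>
     (\<exists>(k::nat) P g.
        (\<forall>i<k. clopen_in X (P i)) \<and> disjoint_family_on P {..<k} \<and> A = (\<Union>i<k. P i) \<and>
        (\<forall>i<k. g i \<in> carrier G) \<and>
        disjoint_family_on (\<lambda>i. \<phi> (g i) ` P i) {..<k} \<and>
        (\<forall>i<k. \<phi> (g i) ` P i \<subseteq> B))"

definition admits_comparison ::
    "('g, 'm) monoid_scheme \<Rightarrow> 'x topology \<Rightarrow> ('g \<Rightarrow> 'x \<Rightarrow> 'x) \<Rightarrow> bool" where
  "admits_comparison G X \<phi> \<longleftrightarrow>
     (\<forall>A B. clopen_in X A \<and> clopen_in X B \<and>
            (\<forall>\<mu>. invariant_borel_prob G X \<phi> \<mu> \<longrightarrow> measure \<mu> A < measure \<mu> B) \<longrightarrow>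
            subequivalent G X \<phi> A B)"

text \<open>
  HOL cannot quantify over types inside a formula, so the type in which the points of the
  spaces live is a parameter. A theorem concluding \<open>comparison_property TYPE('x) G\<close> for a type
  variable \<open>'x\<close> unrelated to \<open>G\<close> covers every space.
\<close>

definition comparison_property :: "'x itself \<Rightarrow> ('g, 'm) monoid_scheme \<Rightarrow> bool" where
  "comparison_property (_ :: 'x itself) G \<longleftrightarrow>
     (\<forall>(X :: 'x topology) \<phi>.
        zero_dim_compact_metric_space X \<and> action_by_homeomorphisms G X \<phi> \<longrightarrow>
        admits_comparison G X \<phi>)"

end

theory Submission
  imports Defs "HOL-Algebra.Generated_Groups" "HOL-Real_Asymp.Real_Asymp"
begin

text \<open>
  A Folner averaging argument turns the hypothesis on invariant measures into a pointwise one: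
  there is a finite window \<open>F \<subseteq> G\<close> such that every point visits \<open>A\<close> strictly less often than \<open>B\<close>
  along \<open>F\<close>. Join \<open>a \<in> A\<close> to \<open>s a \<in> B\<close> for \<open>s \<in> S = F F\<^sup>-\<^sup>1\<close>; double counting over the windows shows
  that each finite \<open>L \<subseteq> A\<close> has at least \<open>(1 + 1 / |F|) |L|\<close> neighbours. Hence, for any matching,
  the alternating walks from an unmatched point spread exponentially, which subexponential
  growth forbids unless an augmenting walk of bounded length exists.

  As in the Hopcroft--Karp algorithm, the matching is augmented along shortest walks only. All
  walks spelled by one word in \<open>S\<close> are flipped simultaneously: the group elements and the matching are
  injective, and distance labels separate the stages of a walk, so these flips do not interfere,
  whether or not the action is free. Finitely many words then suffice to raise the
  shortest length by one, and every step keeps the matching piecewise given by group elements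
  on clopen sets. After finitely many rounds no point of \<open>A\<close> is left unmatched.
\<close>

section \<open>Growth and Folner sets\<close>

lemma set_power_carrier_update: "set_power (G\<lparr>carrier := H\<rparr>) S n = set_power G S n"
  by (induction n) (simp_all add: set_mult_def)

context group
begin

lemma set_power_closed: "S \<subseteq> carrier G \<Longrightarrow> set_power G S n \<subseteq> carrier G"
  by (induction n) (simp_all add: set_mult_closed)

lemma finite_set_mult: "finite S \<Longrightarrow> finite T \<Longrightarrow> finite (S <#> T)"
  by (auto simp: set_mult_def)

lemma finite_set_power: "finite S \<Longrightarrow> finite (set_power G S n)"
  by (induction n) (auto intro: finite_set_mult)

lemma set_power_add:
  assumes "S \<subseteq> carrier G"
  shows "set_power G S (m + n) = set_power G S m <#> set_power G S n"
proof (induction n)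
  case 0
  then show ?case using set_power_closed[OF assms, of m] by (force simp: set_mult_def)
next
  case (Suc n)
  then show ?case by (simp add: set_mult_assoc set_power_closed assms)
qed

lemma set_power_1: "S \<subseteq> carrier G \<Longrightarrow> set_power G S 1 = S"
  by (force simp: set_mult_def)

lemma set_power_Suc_left:
  assumes "S \<subseteq> carrier G"
  shows "set_power G S (Suc n) = S <#> set_power G S n"
  using set_power_add[OF assms, of 1 n] set_power_1[OF assms] by simp

lemma set_power_subset_Suc:
  assumes "S \<subseteq> carrier G" "\<one> \<in> S"
  shows "set_power G S n \<subseteq> set_power G S (Suc n)"
proof
  fix x assume "x \<in> set_power G S n"
  moreover have "x = x \<otimes> \<one>" using set_power_closed[OF assms(1), of n] calculation by auto
  ultimately show "x \<in> set_power G S (Suc n)" using assms(2) by (auto simp: set_mult_def)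
qed

text \<open>Change of generators: a letter of \<open>S\<close> is spelled by at most
  \<open>k\<close> letters of \<open>T\<close>, so lengths multiply. The union over
  \<open>i \<le> k * n\<close> appears because \<open>T\<close> need not contain
  \<open>\<one>\<close>, so its powers need not be nested.\<close>

lemma set_power_subset_UN:
  assumes "T \<subseteq> carrier G" "S \<subseteq> (\<Union>i\<le>k. set_power G T i)"
  shows "set_power G S n \<subseteq> (\<Union>i\<le>k * n. set_power G T i)"
proof (induction n)
  case 0
  then show ?case by auto
next
  case (Suc n)
  show ?case
  proof
    fix x assume "x \<in> set_power G S (Suc n)"
    then obtain y s where ys: "y \<in> set_power G S n" "s \<in> S" "x = y \<otimes> s" by (auto simp: set_mult_def)
    obtain i where i: "i \<le> k * n" "y \<in> set_power G T i" using Suc ys by blast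
    obtain j where j: "j \<le> k" "s \<in> set_power G T j" using assms(2) ys by blast
    have "x \<in> set_power G T (i + j)"
      using i j ys unfolding set_power_add[OF assms(1)] by (auto simp: set_mult_def)
    moreover have "i + j \<le> k * Suc n" using i j by simp
    ultimately show "x \<in> (\<Union>i\<le>k * Suc n. set_power G T i)" by blast
  qed
qed

text \<open>Right translation by a fixed element of \<open>T\<close> embeds each power into the next
  one, which works even when the powers are not nested.\<close>

lemma card_set_power_mono:
  assumes "finite T" "T \<subseteq> carrier G" "T \<noteq> {}" "i \<le> j"
  shows "card (set_power G T i) \<le> card (set_power G T j)"
  using assms(4)
proof (induction j rule: dec_induct)
  case (step n)
  obtain t where t: "t \<in> T" using assms(3) by blast
  have "card (set_power G T n) \<le> card (set_power G T (Suc n))"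
  proof (rule card_inj_on_le)
    show "inj_on (\<lambda>x. x \<otimes> t) (set_power G T n)"
      using set_power_closed[OF assms(2), of n] t assms(2) by (intro inj_onI) (simp add: subset_iff)
    show "(\<lambda>x. x \<otimes> t) ` set_power G T n \<subseteq> set_power G T (Suc n)"
      using t by (auto simp: set_mult_def)
  qed (rule finite_set_power[OF assms(1)])
  then show ?case using step by simp
qed simp

lemma card_set_power_pos:
  assumes "finite T" "T \<subseteq> carrier G" "T \<noteq> {}"
  shows "0 < card (set_power G T i)"
  using card_set_power_mono[OF assms, of 0 i] by simp

lemma set_inv_subgroup:
  assumes "subgroup H G" "R \<subseteq> H"
  shows "set_inv\<^bsub>G\<lparr>carrier := H\<rparr>\<^esub> R = (\<lambda>s. inv s) ` R"
proof -
  have "set_inv\<^bsub>G\<lparr>carrier := H\<rparr>\<^esub> R = (\<Union>h\<in>R. {inv h})"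
    unfolding SET_INV_def using assms m_inv_consistent by (intro SUP_cong) auto
  then show ?thesis by blast
qed

text \<open>The identity is adjoined for the sake of \<open>S = {}\<close>: the exponents in
  \<open>finite_generator\<close> start at one, and those powers of the empty set are empty.\<close>

lemma finite_generator_generate:
  assumes "finite S" "S \<subseteq> carrier G"
  shows "finite_generator (G\<lparr>carrier := generate G S\<rparr>) (insert \<one> S)"
proof -
  define H where "H = generate G S"
  have sub: "subgroup H G" unfolding H_def by (rule generate_is_subgroup[OF assms(2)])
  define T where "T = insert \<one> S \<union> set_inv\<^bsub>G\<lparr>carrier := H\<rparr>\<^esub> (insert \<one> S)"
  have SH: "insert \<one> S \<subseteq> H" unfolding H_def by (auto intro: generate.intros)
  have T: "T = insert \<one> S \<union> (\<lambda>s. inv s) ` insert \<one> S"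
    unfolding T_def set_inv_subgroup[OF sub SH] ..
  have TH: "T \<subseteq> H" using SH subgroup.m_inv_closed[OF sub] unfolding T by blast
  have HG: "H \<subseteq> carrier G" using sub by (rule subgroup.subset)
  have TG: "T \<subseteq> carrier G" using TH HG by blast
  have "set_power G T n \<subseteq> H" for n
  proof (induction n)
    case 0
    then show ?case using subgroup.one_closed[OF sub] by simp
  next
    case (Suc n)
    then show ?case using TH subgroup.m_closed[OF sub] by (auto simp: set_mult_def subset_iff)
  qed
  moreover have "\<exists>n\<ge>1. h \<in> set_power G T n" if "h \<in> H" for h
    using that unfolding H_def
  proof (induction h rule: generate.induct)
    case one
    have "\<one> \<in> T" by (simp add: T)
    then show ?case using set_power_1[OF TG] by (metis order_refl)
  next
    case (incl h)
    then have "h \<in> T" by (simp add: T)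
    then show ?case using set_power_1[OF TG] by (metis order_refl)
  next
    case (inv h)
    then have "inv h \<in> T" by (simp add: T)
    then show ?case using set_power_1[OF TG] by (metis order_refl)
  next
    case (eng h1 h2)
    then obtain m n where "m \<ge> 1" "h1 \<in> set_power G T m" "h2 \<in> set_power G T n" by blast
    then have "h1 \<otimes> h2 \<in> set_power G T (m + n)" "m + n \<ge> 1"
      unfolding set_power_add[OF TG] by (auto simp: set_mult_def)
    then show ?case by blast
  qed
  ultimately have "(\<Union>n\<in>{1..}. set_power G T n) = H" by (intro equalityI subsetI) fastforce+
  then have "finite_generator (G\<lparr>carrier := H\<rparr>) (insert \<one> S)"
    using assms(1) SH
    unfolding finite_generator_def sym_power_def T_def[symmetric] set_power_carrier_update by simp
  then show ?thesis by (simp add: H_def)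
qed

end

lemma finite_subset_UN_nat:
  assumes "finite S" "S \<subseteq> (\<Union>n. A (n::nat))"
  shows "\<exists>k. S \<subseteq> (\<Union>i\<le>k. A i)"
proof -
  have "\<forall>s\<in>S. \<exists>n. s \<in> A n" using assms(2) by blast
  then obtain f where f: "\<forall>s\<in>S. s \<in> A (f s)" by metis
  then have "S \<subseteq> (\<Union>i\<le>Max (f ` S). A i)" using assms(1) by (auto intro!: bexI[of _ "f _"])
  then show ?thesis ..
qed

text \<open>Links the growth hypothesis, which speaks of some generator \<open>R\<close> of the
  subgroup generated by \<open>S\<close>, to the arbitrary finite set \<open>S\<close>. Spelling
  words over \<open>S\<close> in the symmetrised generator \<open>T\<close> costs a factor linear in
  \<open>n\<close> and rescales lengths by \<open>k\<close>; an exponential beats both.\<close>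

lemma card_set_power_less_power:
  fixes G :: "('g, 'm) monoid_scheme" (structure)
  assumes G: "subexponential_group G" and S: "finite S" "S \<subseteq> carrier G" and c: "1 < (c::real)"
  shows "\<exists>n. real (card (set_power G S n)) < c ^ n"
proof -
  interpret group G using G by (simp add: subexponential_group_def)
  define H where "H = generate G S"
  have sub: "subgroup H G" unfolding H_def by (rule generate_is_subgroup[OF S(2)])
  have "subexponential_growth (G\<lparr>carrier := H\<rparr>)"
    using G sub finite_generator_generate[OF S] unfolding subexponential_group_def H_def by blast
  then obtain R where R: "finite_generator (G\<lparr>carrier := H\<rparr>) R"
    and lim: "(\<lambda>n. (1 / real n) * ln (real (card (sym_power (G\<lparr>carrier := H\<rparr>) R n)))) \<longlonglongrightarrow> 0"
    unfolding subexponential_growth_def by blast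
  define T where "T = R \<union> set_inv\<^bsub>G\<lparr>carrier := H\<rparr>\<^esub> R"
  have RH: "finite R" "R \<subseteq> H" and H: "(\<Union>n\<in>{1..}. set_power G T n) = H"
    using R by (auto simp: finite_generator_def sym_power_def set_power_carrier_update T_def)
  have HG: "H \<subseteq> carrier G" using sub by (rule subgroup.subset)
  have "T = R \<union> (\<lambda>s. inv s) ` R"
    unfolding T_def set_inv_subgroup[OF sub RH(2)] ..
  then have T: "finite T" "T \<subseteq> carrier G" using RH HG by auto
  have "T \<noteq> {}"
  proof
    assume T0: "T = {}"
    have "set_power G T n = {}" if n: "n \<ge> 1" for n
      using n by (cases n) (auto simp: set_mult_def T0)
    then have "H = {}" using H by auto
    then show False using subgroup.one_closed[OF sub] by simp
  qed
  note T = T this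
  define a where "a n = card (set_power G T n)" for n
  have lim: "(\<lambda>n. (1 / real n) * ln (real (a n))) \<longlonglongrightarrow> 0"
    using lim by (simp add: a_def sym_power_def set_power_carrier_update T_def)
  have "S \<subseteq> (\<Union>n. set_power G T n)"
    using H generate.incl[of _ S G] unfolding H_def by blast
  then obtain k0 where "S \<subseteq> (\<Union>i\<le>k0. set_power G T i)" using finite_subset_UN_nat S(1) by metis
  \<comment> \<open>Passing to a successor makes the length bound positive, as needed for dividing
    by \<open>k\<close> and for \<open>k * n\<close> to tend to infinity.\<close>
  then have k: "S \<subseteq> (\<Union>i\<le>Suc k0. set_power G T i)" by fastforce
  define k where "k = Suc k0"
  note k = k[folded k_def]
  have k0: "0 < k" by (simp add: k_def)
  have bound: "real (card (set_power G S n)) \<le> (real k * real n + 1) * real (a (k * n))" for n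
  proof -
    have "card (set_power G S n) \<le> card (\<Union>i\<le>k * n. set_power G T i)"
      by (intro card_mono set_power_subset_UN T k finite_UN_I finite_set_power) auto
    also have "\<dots> \<le> (\<Sum>i\<le>k * n. a i)" unfolding a_def by (rule card_UN_le) simp
    also have "\<dots> \<le> (\<Sum>i\<le>k * n. a (k * n))"
      unfolding a_def by (intro sum_mono card_set_power_mono T) auto
    finally have "card (set_power G S n) \<le> Suc (k * n) * a (k * n)" by simp
    then have "real (card (set_power G S n)) \<le> real (Suc (k * n) * a (k * n))"
      by (rule of_nat_mono)
    then show ?thesis by (simp add: algebra_simps)
  qed
  \<comment> \<open>Half of the rate \<open>ln c\<close> absorbs \<open>a (k * n)\<close>, the other
    half the linear factor.\<close>
  define d where "d = ln c / 2"
  have d: "0 < d" using c by (simp add: d_def)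
  have ev: "eventually (\<lambda>m. (1 / real m) * ln (real (a m)) < d / k) sequentially"
    using d k0 by (intro order_tendstoD(2)[OF lim]) auto
  have "filterlim (\<lambda>n. k * n) sequentially sequentially"
    using k0 by (intro filterlim_subseq) (simp add: strict_mono_def)
  from eventually_compose_filterlim[OF ev this]
  have "eventually (\<lambda>n. (1 / real (k * n)) * ln (real (a (k * n))) < d / k) sequentially" .
  moreover have "eventually (\<lambda>n. real k * real n + 1 < exp (d * real n)) sequentially"
    using d k0 by real_asymp
  moreover have "eventually (\<lambda>n::nat. n > 0) sequentially" by (rule eventually_gt_at_top)
  ultimately have "eventually (\<lambda>n. real (card (set_power G S n)) < c ^ n) sequentially"
  proof eventually_elim
    case (elim n)
    have pos: "0 < a (k * n)" unfolding a_def by (rule card_set_power_pos[OF T])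
    have "ln (real (a (k * n))) < d * real n"
      using elim(1,3) k0 by (simp add: field_simps)
    then have "real (a (k * n)) < exp (d * real n)" using pos
      by (metis exp_less_mono exp_ln of_nat_0_less_iff)
    then have "(real k * real n + 1) * real (a (k * n)) < exp (d * real n) * exp (d * real n)"
      using elim(2) pos by (intro mult_strict_mono) auto
    also have "\<dots> = c ^ n"
    proof -
      have "exp (d * real n) * exp (d * real n) = exp (real n * ln c)"
        by (simp add: d_def mult.commute flip: exp_add)
      also have "\<dots> = c ^ n" using c by (simp add: exp_of_nat_mult)
      finally show ?thesis .
    qed
    finally show ?case using bound[of n] by linarith
  qed
  then show ?thesis by (rule eventually_happens'[OF sequentially_bot])
qed

text \<open>If no ratio of consecutive powers of \<open>insert \<one> K\<close> were at most
  \<open>1 + e\<close>, these powers would grow exponentially. \<open>F\<close> and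
  \<open>F'\<close> are two consecutive powers; taking \<open>F'\<close> to contain \<open>F\<close>
  and its translates by \<open>K\<close> replaces the usual bound on symmetric differences.\<close>

lemma folner:
  fixes G :: "('g, 'm) monoid_scheme" (structure)
  assumes G: "subexponential_group G" and K: "finite K" "K \<subseteq> carrier G" and e: "0 < (e::real)"
  shows "\<exists>F F'. finite F' \<and> F \<noteq> {} \<and> F \<subseteq> F' \<and> F' \<subseteq> carrier G \<and> (\<forall>g\<in>K. \<forall>f\<in>F. g \<otimes> f \<in> F') \<and>
     real (card F') \<le> (1 + e) * real (card F)"
proof -
  interpret group G using G by (simp add: subexponential_group_def)
  define S where "S = insert \<one> K"
  have S: "finite S" "S \<subseteq> carrier G" "\<one> \<in> S" using K by (auto simp: S_def)
  obtain n where n: "real (card (set_power G S (Suc n))) \<le> (1 + e) * real (card (set_power G S n))"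
  proof (rule ccontr)
    assume "\<not> thesis"
    then have less: "(1 + e) * real (card (set_power G S n)) \<le> real (card (set_power G S (Suc n)))" for n
      using that by (meson less_imp_le not_le)
    have "(1 + e) ^ n \<le> real (card (set_power G S n))" for n
    proof (induction n)
      case (Suc n)
      have "(1 + e) ^ Suc n \<le> (1 + e) * real (card (set_power G S n))" using Suc e by simp
      then show ?case using less[of n] by linarith
    qed simp
    then show False using card_set_power_less_power[OF G S(1,2), of "1 + e"] e by (metis less_add_same_cancel1 not_le)
  qed
  \<comment> \<open>The recursion of \<open>set_power\<close> appends letters on the right, whereas
    \<open>K\<close> multiplies from the left.\<close>
  have "g \<otimes> f \<in> set_power G S (Suc n)" if "g \<in> K" "f \<in> set_power G S n" for g f
    using that unfolding set_power_Suc_left[OF S(2)] by (auto simp: S_def set_mult_def)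
  moreover have "set_power G S n \<noteq> {}"
    using card_set_power_pos[OF S(1,2), of n] S(3) by fastforce
  moreover have "finite (set_power G S (Suc n))" by (rule finite_set_power[OF S(1)])
  moreover note set_power_subset_Suc[OF S(2,3), of n] set_power_closed[OF S(2), of "Suc n"] n
  ultimately show ?thesis
    by (intro exI[of _ "set_power G S n"] exI[of _ "set_power G S (Suc n)"] conjI ballI) assumption+
qed


section \<open>Clopen matchings\<close>

locale clopen_action = group_action G "topspace X" \<phi>
  for G :: "('g, 'm) monoid_scheme" (structure) and X :: "'x topology" and \<phi> +
  assumes homeo: "g \<in> carrier G \<Longrightarrow> homeomorphic_map X X (\<phi> g)"
begin

sublocale group G
  using group_hom group_hom.axioms(1) by auto

lemma clopen_subset: "clopen_in X C \<Longrightarrow> C \<subseteq> topspace X"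
  by (simp add: clopen_in_def openin_subset)

lemma clopen_empty: "clopen_in X {}"
  by (simp add: clopen_in_def)

lemma clopen_topspace: "clopen_in X (topspace X)"
  by (simp add: clopen_in_def)

lemma clopen_Int: "clopen_in X C \<Longrightarrow> clopen_in X D \<Longrightarrow> clopen_in X (C \<inter> D)"
  by (auto simp: clopen_in_def)

lemma clopen_Un: "clopen_in X C \<Longrightarrow> clopen_in X D \<Longrightarrow> clopen_in X (C \<union> D)"
  by (auto simp: clopen_in_def)

lemma clopen_Diff: "clopen_in X C \<Longrightarrow> clopen_in X D \<Longrightarrow> clopen_in X (C - D)"
  by (auto simp: clopen_in_def openin_diff closedin_diff)

lemma clopen_UN: "finite I \<Longrightarrow> (\<And>i. i \<in> I \<Longrightarrow> clopen_in X (C i)) \<Longrightarrow> clopen_in X (\<Union>i\<in>I. C i)"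
  by (induction I rule: finite_induct) (auto intro: clopen_empty clopen_Un)

lemma clopen_image: "g \<in> carrier G \<Longrightarrow> clopen_in X C \<Longrightarrow> clopen_in X (\<phi> g ` C)"
  unfolding clopen_in_def
  by (meson homeo homeomorphic_map_closedness_eq homeomorphic_map_openness_eq)

lemma clopen_vimage:
  "g \<in> carrier G \<Longrightarrow> clopen_in X C \<Longrightarrow> clopen_in X {x \<in> topspace X. \<phi> g x \<in> C}"
  unfolding clopen_in_def
  using homeomorphic_imp_continuous_map[OF homeo]
  by (auto intro: openin_continuous_map_preimage closedin_continuous_map_preimage)

lemma act_inj: "g \<in> carrier G \<Longrightarrow> x \<in> topspace X \<Longrightarrow> y \<in> topspace X \<Longrightarrow> \<phi> g x = \<phi> g y \<Longrightarrow> x = y"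
  using inj_prop by (meson inj_on_eq_iff)

lemma act_inv: "g \<in> carrier G \<Longrightarrow> x \<in> topspace X \<Longrightarrow> \<phi> (inv g) (\<phi> g x) = x"
  using orbit_sym_aux by simp

section \<open>Relations given by group elements on clopen sets\<close>

definition piece :: "'g \<Rightarrow> 'x set \<Rightarrow> ('x \<times> 'x) set" where
  "piece g C = {(x, \<phi> g x) |x. x \<in> C}"

text \<open>Pieces may overlap, so the many-valued edge relation and its matchings fall under the
  same notion; single-valuedness and injectivity are imposed separately.\<close>

definition piecewise :: "('x \<times> 'x) set \<Rightarrow> bool" where
  "piecewise M \<longleftrightarrow>
     (\<exists>T. finite T \<and> (\<forall>(g, C)\<in>T. g \<in> carrier G \<and> clopen_in X C) \<and> M = (\<Union>(g, C)\<in>T. piece g C))"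

lemma piecewise_empty: "piecewise {}"
  unfolding piecewise_def by (rule exI[of _ "{}"]) auto

lemma piecewise_piece: "g \<in> carrier G \<Longrightarrow> clopen_in X C \<Longrightarrow> piecewise (piece g C)"
  unfolding piecewise_def by (rule exI[of _ "{(g, C)}"]) auto

lemma piecewise_Un:
  assumes "piecewise M" "piecewise N" shows "piecewise (M \<union> N)"
proof -
  obtain T T' where
    "finite T" "\<forall>(g, C)\<in>T. g \<in> carrier G \<and> clopen_in X C" "M = (\<Union>(g, C)\<in>T. piece g C)"
    "finite T'" "\<forall>(g, C)\<in>T'. g \<in> carrier G \<and> clopen_in X C" "N = (\<Union>(g, C)\<in>T'. piece g C)"
    using assms unfolding piecewise_def by blast
  then show ?thesis
    unfolding piecewise_def by (intro exI[of _ "T \<union> T'"]) auto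
qed

lemma piecewise_UN: "finite I \<Longrightarrow> (\<And>i. i \<in> I \<Longrightarrow> piecewise (M i)) \<Longrightarrow> piecewise (\<Union>i\<in>I. M i)"
  by (induction I rule: finite_induct) (auto intro: piecewise_empty piecewise_Un)

lemma piecewiseE:
  assumes "piecewise M"
  obtains T where "finite T"
    "\<And>g C. (g, C) \<in> T \<Longrightarrow> g \<in> carrier G \<and> clopen_in X C \<and> C \<subseteq> topspace X"
    "\<And>a b. (a, b) \<in> M \<longleftrightarrow> (\<exists>g C. (g, C) \<in> T \<and> a \<in> C \<and> b = \<phi> g a)"
proof -
  obtain T where "finite T" "\<forall>(g, C)\<in>T. g \<in> carrier G \<and> clopen_in X C" "M = (\<Union>(g, C)\<in>T. piece g C)"
    using assms unfolding piecewise_def by blast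
  then show thesis by (intro that[of T]) (auto simp: piece_def dest: subsetD[OF clopen_subset])
qed

lemma piecewise_restrict:
  assumes "piecewise M" "clopen_in X C" "clopen_in X D"
  shows "piecewise (M \<inter> C \<times> D)"
proof -
  obtain T where T: "finite T"
    "\<And>g C. (g, C) \<in> T \<Longrightarrow> g \<in> carrier G \<and> clopen_in X C \<and> C \<subseteq> topspace X"
    "\<And>a b. (a, b) \<in> M \<longleftrightarrow> (\<exists>g C. (g, C) \<in> T \<and> a \<in> C \<and> b = \<phi> g a)"
    by (rule piecewiseE[OF assms(1)]) (rule that)
  have eq: "M \<inter> C \<times> D = (\<Union>(g, P)\<in>T. piece g (P \<inter> C \<inter> {x \<in> topspace X. \<phi> g x \<in> D}))"
  proof (intro equalityI subrelI)
    fix a b assume "(a, b) \<in> M \<inter> C \<times> D"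
    then have "(a, b) \<in> M" "a \<in> C" "b \<in> D" by auto
    then obtain g P where "(g, P) \<in> T" "a \<in> P" "b = \<phi> g a" using T(3) by blast
    then show "(a, b) \<in> (\<Union>(g, P)\<in>T. piece g (P \<inter> C \<inter> {x \<in> topspace X. \<phi> g x \<in> D}))"
      using \<open>a \<in> C\<close> \<open>b \<in> D\<close> T(2) by (auto simp: piece_def intro!: bexI[of _ "(g, P)"])
  qed (auto simp: piece_def T(3))
  show ?thesis unfolding eq
    using T by (intro piecewise_UN) (auto intro!: piecewise_piece clopen_Int clopen_vimage assms)
qed

lemma clopen_Image:
  assumes "piecewise M" "clopen_in X D" shows "clopen_in X (M `` D)"
proof -
  obtain T where T: "finite T"
    "\<And>g C. (g, C) \<in> T \<Longrightarrow> g \<in> carrier G \<and> clopen_in X C \<and> C \<subseteq> topspace X"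
    "\<And>a b. (a, b) \<in> M \<longleftrightarrow> (\<exists>g C. (g, C) \<in> T \<and> a \<in> C \<and> b = \<phi> g a)"
    by (rule piecewiseE[OF assms(1)]) (rule that)
  have eq: "M `` D = (\<Union>(g, P)\<in>T. \<phi> g ` (P \<inter> D))"
    by (fastforce simp: Image_iff T(3))
  show ?thesis unfolding eq
    using T by (intro clopen_UN) (auto intro!: clopen_image clopen_Int assms)
qed

lemma clopen_converse_Image:
  assumes "piecewise M" "clopen_in X D" shows "clopen_in X (M\<inverse> `` D)"
proof -
  obtain T where T: "finite T"
    "\<And>g C. (g, C) \<in> T \<Longrightarrow> g \<in> carrier G \<and> clopen_in X C \<and> C \<subseteq> topspace X"
    "\<And>a b. (a, b) \<in> M \<longleftrightarrow> (\<exists>g C. (g, C) \<in> T \<and> a \<in> C \<and> b = \<phi> g a)"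
    by (rule piecewiseE[OF assms(1)]) (rule that)
  have eq: "M\<inverse> `` D = (\<Union>(g, P)\<in>T. P \<inter> {x \<in> topspace X. \<phi> g x \<in> D})"
  proof (intro equalityI subsetI)
    fix x assume "x \<in> M\<inverse> `` D"
    then obtain y where "(x, y) \<in> M" "y \<in> D" by blast
    then obtain g P where "(g, P) \<in> T" "x \<in> P" "\<phi> g x \<in> D" by (auto simp: T(3))
    then show "x \<in> (\<Union>(g, P)\<in>T. P \<inter> {x \<in> topspace X. \<phi> g x \<in> D})"
      using T(2) by (auto intro!: bexI[of _ "(g, P)"])
  next
    fix x assume "x \<in> (\<Union>(g, P)\<in>T. P \<inter> {x \<in> topspace X. \<phi> g x \<in> D})"
    then obtain g P where "(g, P) \<in> T" "x \<in> P" "\<phi> g x \<in> D" by auto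
    then show "x \<in> M\<inverse> `` D" by (auto simp: Image_iff T(3))
  qed
  show ?thesis unfolding eq
    using T by (intro clopen_UN) (auto intro!: clopen_vimage clopen_Int assms)
qed

lemma piecewise_subset: "piecewise M \<Longrightarrow> M \<subseteq> topspace X \<times> topspace X"
  by (erule piecewiseE) (fastforce intro: element_image)

lemma clopen_Domain: "piecewise M \<Longrightarrow> clopen_in X (Domain M)"
proof -
  assume M: "piecewise M"
  then have "Domain M = M\<inverse> `` topspace X" using piecewise_subset by auto
  then show ?thesis using clopen_converse_Image[OF M clopen_topspace] by simp
qed

lemma clopen_Range: "piecewise M \<Longrightarrow> clopen_in X (Range M)"
proof -
  assume M: "piecewise M"
  then have "Range M = M `` topspace X" using piecewise_subset by auto
  then show ?thesis using clopen_Image[OF M clopen_topspace] by simp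
qed

end

section \<open>Matchings in the bipartite graph between \<open>A\<close> and
  \<open>B\<close>\<close>

locale matching_problem = clopen_action G X \<phi>
  for G :: "('g, 'm) monoid_scheme" (structure) and X :: "'x topology" and \<phi> +
  fixes A B :: "'x set" and S :: "'g set"
  assumes clopen_A: "clopen_in X A" and clopen_B: "clopen_in X B"
    and finite_S: "finite S" and S_carrier: "S \<subseteq> carrier G"
begin

text \<open>Edges are pairs of points and forget which \<open>s\<close> joins them, so coincidences
  among the points \<open>\<phi> s a\<close> in a non-free action cause no trouble.\<close>

definition edges :: "('x \<times> 'x) set" where
  "edges = {(a, \<phi> s a) |a s. a \<in> A \<and> s \<in> S \<and> \<phi> s a \<in> B}"

lemma edges_iff: "(a, b) \<in> edges \<longleftrightarrow> a \<in> A \<and> b \<in> B \<and> (\<exists>s\<in>S. b = \<phi> s a)"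
  by (auto simp: edges_def)

lemma piecewise_edges: "piecewise edges"
proof -
  have eq: "edges = (\<Union>s\<in>S. piece s (A \<inter> {x \<in> topspace X. \<phi> s x \<in> B}))"
    using clopen_subset[OF clopen_A] by (auto simp: edges_def piece_def)
  show ?thesis unfolding eq
    using S_carrier
    by (intro piecewise_UN finite_S piecewise_piece clopen_Int clopen_A clopen_vimage clopen_B) auto
qed

definition matching :: "('x \<times> 'x) set \<Rightarrow> bool" where
  "matching M \<longleftrightarrow> piecewise M \<and> M \<subseteq> edges \<and> single_valued M \<and> single_valued (M\<inverse>)"

text \<open>\<open>valid p M\<close> makes \<open>p\<close> a lower bound for the number of matched edges on a walk from \<open>b\<close> to a
  free point, provided that \<open>p\<close> vanishes on the free points.\<close>

definition valid :: "('x \<Rightarrow> nat) \<Rightarrow> ('x \<times> 'x) set \<Rightarrow> bool" where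
  "valid p M \<longleftrightarrow> (\<forall>a b b'. (a, b) \<in> M \<longrightarrow> (a, b') \<in> edges \<longrightarrow> p b \<le> p b' + 1)"

text \<open>\<open>descend p M w\<close>: starting points \<open>b\<close> of the walks that alternately follow a matched edge
  backwards and apply the next letter of \<open>w\<close>, with \<open>p\<close> dropping by exactly one per letter, and
  that end at a free point.\<close>

primrec descend :: "('x \<Rightarrow> nat) \<Rightarrow> ('x \<times> 'x) set \<Rightarrow> 'g list \<Rightarrow> 'x set" where
  "descend p M [] = {b \<in> B. p b = 0} - Range M"
| "descend p M (s # w) =
     {b \<in> B. p b = Suc (length w)} \<inter> M `` {a \<in> A. \<phi> s a \<in> descend p M w}"

lemma descend_subset: "descend p M w \<subseteq> {b \<in> B. p b = length w}"
  by (cases w) auto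

lemma clopen_descend:
  assumes "\<And>j. clopen_in X {b \<in> B. p b = j}" "piecewise M" "set w \<subseteq> S"
  shows "clopen_in X (descend p M w)"
  using assms(3)
proof (induction w)
  case Nil
  then show ?case using assms by (auto intro!: clopen_Diff clopen_Range)
next
  case (Cons s w)
  have "{a \<in> A. \<phi> s a \<in> descend p M w} = A \<inter> {x \<in> topspace X. \<phi> s x \<in> descend p M w}"
    using clopen_subset[OF clopen_A] by auto
  then have "clopen_in X {a \<in> A. \<phi> s a \<in> descend p M w}"
    using Cons S_carrier by (auto intro!: clopen_Int clopen_A clopen_vimage)
  then show ?case using assms by (auto intro!: clopen_Int clopen_Image)
qed

lemma single_valued_conv: "single_valued (M\<inverse>) \<longleftrightarrow> (\<forall>a a' b. (a, b) \<in> M \<longrightarrow> (a', b) \<in> M \<longrightarrow> a = a')"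
  by (auto simp: single_valued_def)

text \<open>The key invariant for simultaneous flips: moving the tokens in \<open>U\<close> one step creates no new
  descending walk, because all neighbours of \<open>U\<close> carry labels at least \<open>n\<close>.\<close>

lemma push_step:
  assumes M: "matching M" and val: "valid p M"
    and U: "clopen_in X U" "U \<subseteq> A - Domain M" and s: "s \<in> S" and V: "\<phi> s ` U \<subseteq> {b \<in> B. p b = n}"
    and low: "\<forall>a\<in>U. \<forall>b. (a, b) \<in> edges \<longrightarrow> n \<le> p b"
  defines "M1 \<equiv> (M \<inter> topspace X \<times> (topspace X - \<phi> s ` U)) \<union> piece s U"
  shows "matching M1" "valid p M1" "Range M1 = Range M \<union> \<phi> s ` U"
    "Domain M1 = (Domain M - M\<inverse> `` (\<phi> s ` U)) \<union> U"
    "\<And>w. set w \<subseteq> S \<Longrightarrow> descend p M1 w \<subseteq> descend p M w"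
    "\<And>w. \<phi> s ` U \<subseteq> Range M \<Longrightarrow> length w < n \<Longrightarrow> descend p M w \<subseteq> descend p M1 w"
proof -
  have sG: "s \<in> carrier G" using s S_carrier by auto
  have Mpw: "piecewise M" and ME: "M \<subseteq> edges" and sv: "single_valued M" "single_valued (M\<inverse>)"
    using M by (auto simp: matching_def)
  note MX = piecewise_subset[OF Mpw]
  have iff: "(a, b) \<in> M1 \<longleftrightarrow> ((a, b) \<in> M \<and> b \<notin> \<phi> s ` U) \<or> (a \<in> U \<and> b = \<phi> s a)" for a b
    using MX by (auto simp: M1_def piece_def)
  have UX: "U \<subseteq> topspace X" using U clopen_subset by auto
  have pw: "piecewise M1" unfolding M1_def
    by (intro piecewise_Un piecewise_restrict Mpw clopen_topspace clopen_Diff clopen_image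
        piecewise_piece sG U)
  have sE: "(a, \<phi> s a) \<in> edges" if "a \<in> U" for a
    using that U V s by (auto simp: edges_iff)
  have sub: "M1 \<subseteq> edges" using ME sE by (auto simp: iff)
  have sv1: "single_valued M1"
    using sv(1) U(2) unfolding single_valued_def iff by blast
  have sv2: "single_valued (M1\<inverse>)"
    using sv(2) act_inj[OF sG] UX unfolding single_valued_conv iff by blast
  show "matching M1" using pw sub sv1 sv2 by (simp add: matching_def)
  show "valid p M1"
    unfolding valid_def iff
  proof (intro allI impI)
    fix a b b' assume ab: "((a, b) \<in> M \<and> b \<notin> \<phi> s ` U) \<or> (a \<in> U \<and> b = \<phi> s a)"
      and ab': "(a, b') \<in> edges"
    from ab show "p b \<le> p b' + 1"
    proof
      assume "(a, b) \<in> M \<and> b \<notin> \<phi> s ` U"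
      then show ?thesis using val ab' by (auto simp: valid_def)
    next
      assume "a \<in> U \<and> b = \<phi> s a"
      then have "p b = n" "n \<le> p b'" using V low ab' by auto
      then show ?thesis by simp
    qed
  qed
  show "Range M1 = Range M \<union> \<phi> s ` U" unfolding Range_iff set_eq_iff Un_iff iff by blast
  show "Domain M1 = (Domain M - M\<inverse> `` (\<phi> s ` U)) \<union> U"
    using sv(1) unfolding Domain_iff set_eq_iff Un_iff iff single_valued_def by blast
  note R = \<open>Range M1 = Range M \<union> \<phi> s ` U\<close>
  show "descend p M1 w \<subseteq> descend p M w" if "set w \<subseteq> S" for w
    using that
  proof (induction w)
    case Nil
    then show ?case by (auto simp: R)
  next
    case (Cons t w)
    show ?case
    proof
      fix b assume b: "b \<in> descend p M1 (t # w)"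
      then obtain a where a: "(a, b) \<in> M1" "a \<in> A" "\<phi> t a \<in> descend p M1 w" "b \<in> B" "p b = Suc (length w)"
        by auto
      \<comment> \<open>A descending walk through a new edge would start at label \<open>n\<close>
        and move on to a neighbour of \<open>a \<in> U\<close> with label one less, against
        \<open>low\<close>.\<close>
      have "(a, b) \<in> M"
      proof (rule ccontr)
        assume "(a, b) \<notin> M"
        then have "a \<in> U" "b = \<phi> s a" using a iff by auto
        moreover have "\<phi> t a \<in> B" "p (\<phi> t a) = length w" using a descend_subset by blast+
        moreover have "p b = n" using \<open>a \<in> U\<close> \<open>b = \<phi> s a\<close> V by auto
        moreover have "(a, \<phi> t a) \<in> edges" using a Cons.prems calculation by (auto simp: edges_iff)
        ultimately show False using low a by fastforce
      qed
      then show "b \<in> descend p M (t # w)" using a Cons by auto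
    qed
  qed
  show "descend p M w \<subseteq> descend p M1 w" if VR: "\<phi> s ` U \<subseteq> Range M" and "length w < n" for w
    using that(2)
  proof (induction w)
    case Nil
    then show ?case using VR by (auto simp: R)
  next
    case (Cons t w)
    show ?case
    proof
      fix b assume b: "b \<in> descend p M (t # w)"
      then obtain a where a: "(a, b) \<in> M" "a \<in> A" "\<phi> t a \<in> descend p M w" "b \<in> B" "p b = Suc (length w)"
        by auto
      \<comment> \<open>A walk with fewer than \<open>n\<close> letters starts below label
        \<open>n\<close>, so it never meets the points whose matched edges were replaced.\<close>
      have "b \<notin> \<phi> s ` U" using V a Cons.prems by auto
      then have "(a, b) \<in> M1" using a iff by auto
      then show "b \<in> descend p M1 (t # w)" using a Cons by auto
    qed
  qed
qed

text \<open>Induction along the word. Moving \<open>U\<close> onto its targets displaces their old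
  partners \<open>U1\<close>, which then play the role of \<open>U\<close> for the rest of the word;
  the empty word ends at free points, where nothing is displaced. The labels stay fixed, no
  descending walk is gained, and so words already exhausted remain exhausted.\<close>

lemma push:
  assumes "matching M" "valid p M" "\<And>j. clopen_in X {b \<in> B. p b = j}"
    "clopen_in X U" "U \<subseteq> A - Domain M" "s \<in> S" "set w \<subseteq> S" "\<phi> s ` U \<subseteq> descend p M w"
    "\<forall>a\<in>U. \<forall>b. (a, b) \<in> edges \<longrightarrow> length w \<le> p b"
  shows "\<exists>M'. matching M' \<and> valid p M' \<and> Range M \<subseteq> Range M' \<and> Domain M' = Domain M \<union> U \<and>
     (\<forall>v. set v \<subseteq> S \<longrightarrow> descend p M' v \<subseteq> descend p M v)"
  using assms(1,2,4-)
proof (induction w arbitrary: M U s)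
  case Nil
  define M1 where "M1 = (M \<inter> topspace X \<times> (topspace X - \<phi> s ` U)) \<union> piece s U"
  have V: "\<phi> s ` U \<subseteq> {b \<in> B. p b = 0}" using Nil.prems by auto
  note st = push_step[OF Nil.prems(1-5) V, folded M1_def, simplified]
  have "M\<inverse> `` (\<phi> s ` U) = {}" using Nil.prems(7) by auto
  then show ?case using st by (intro exI[of _ M1]) auto
next
  case (Cons t w)
  define M1 where "M1 = (M \<inter> topspace X \<times> (topspace X - \<phi> s ` U)) \<union> piece s U"
  have V: "\<phi> s ` U \<subseteq> {b \<in> B. p b = Suc (length w)}"
    using descend_subset[of p M "t # w"] Cons.prems by auto
  have low: "\<forall>a\<in>U. \<forall>b. (a, b) \<in> edges \<longrightarrow> Suc (length w) \<le> p b" using Cons.prems(8) by simp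
  note st = push_step[OF Cons.prems(1-5) V low, folded M1_def]
  define U1 where "U1 = M\<inverse> `` (\<phi> s ` U)"
  have VR: "\<phi> s ` U \<subseteq> Range M" using Cons.prems(7) by auto
  have sG: "s \<in> carrier G" using Cons.prems S_carrier by auto
  have M: "M \<subseteq> edges" "single_valued (M\<inverse>)" "piecewise M" using Cons.prems by (auto simp: matching_def)
  have U1: "clopen_in X U1" unfolding U1_def
    by (intro clopen_converse_Image M clopen_image sG Cons.prems)
  have "U1 \<subseteq> Domain M" by (auto simp: U1_def)
  moreover have "Domain M \<subseteq> A" using M by (auto simp: edges_iff)
  ultimately have U1D: "U1 \<subseteq> A - Domain M1" "U1 \<subseteq> Domain M"
    using Cons.prems(4) st(4)[folded U1_def] by blast+
  \<comment> \<open>\<open>descend\<close> only provides some partner of \<open>b\<close> from which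
    the walk continues; as \<open>M\<close> is injective, it is \<open>a\<close> itself. The rest of
    the walk survives the push because its labels are smaller than those of the targets.\<close>
  have tU1: "\<phi> t ` U1 \<subseteq> descend p M1 w"
  proof -
    have "\<phi> t a \<in> descend p M w" if a: "a \<in> U1" for a
    proof -
      obtain b where b: "(a, b) \<in> M" "b \<in> \<phi> s ` U" using a by (auto simp: U1_def)
      then have "b \<in> descend p M (t # w)" using Cons.prems by auto
      then obtain a' where "(a', b) \<in> M" "\<phi> t a' \<in> descend p M w" by auto
      then show ?thesis using M(2) b unfolding single_valued_conv by blast
    qed
    then show ?thesis using st(6)[OF VR, of w] by auto
  qed
  \<comment> \<open>Points of \<open>U1\<close> were matched at label \<open>Suc (length w)\<close>,
    and validity lets their neighbours fall short of it by at most one.\<close>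
  have low1: "\<forall>a\<in>U1. \<forall>b. (a, b) \<in> edges \<longrightarrow> length w \<le> p b"
  proof (intro ballI allI impI)
    fix a b assume a: "a \<in> U1" "(a, b) \<in> edges"
    obtain b' where b: "(a, b') \<in> M" "b' \<in> \<phi> s ` U" using a by (auto simp: U1_def)
    have "p b' = Suc (length w)" using V b by auto
    moreover have "p b' \<le> p b + 1" using Cons.prems(2) b a unfolding valid_def by blast
    ultimately show "length w \<le> p b" by simp
  qed
  obtain M' where M': "matching M'" "valid p M'" "Range M1 \<subseteq> Range M'" "Domain M' = Domain M1 \<union> U1"
     "\<forall>v. set v \<subseteq> S \<longrightarrow> descend p M' v \<subseteq> descend p M1 v"
    using Cons.IH[OF _ _ U1 U1D(1) _ _ tU1 low1] st(1,2) Cons.prems(6) by auto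
  have "Domain M' = Domain M \<union> U" using M'(4) U1D st(4) by (auto simp: U1_def)
  then show ?case using M' st(3,5) by (intro exI[of _ M']) blast
qed

text \<open>The invariant of round \<open>k\<close>. Labels vanish at free points and fall by at
  most one per matched edge, so the last clause forces every alternating walk from an unmatched
  point of \<open>A\<close> to a free point of \<open>B\<close> to use at least \<open>k\<close>
  matched edges.\<close>

definition labelling :: "nat \<Rightarrow> ('x \<Rightarrow> nat) \<Rightarrow> ('x \<times> 'x) set \<Rightarrow> bool" where
  "labelling k p M \<longleftrightarrow> matching M \<and> valid p M \<and> (\<forall>j. clopen_in X {b \<in> B. p b = j}) \<and>
     (\<forall>b \<in> B - Range M. p b = 0) \<and> (\<forall>a b. (a, b) \<in> edges \<longrightarrow> a \<notin> Domain M \<longrightarrow> k \<le> p b)"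

text \<open>The head of \<open>w\<close> leads from an unmatched point into \<open>B\<close> and the
  tail is read by \<open>descend\<close>; hence a word of length \<open>Suc k\<close> describes a
  walk with \<open>k\<close> matched edges.\<close>

definition augmenting :: "('x \<Rightarrow> nat) \<Rightarrow> ('x \<times> 'x) set \<Rightarrow> 'g list \<Rightarrow> 'x set" where
  "augmenting p M w = {a \<in> A - Domain M. \<phi> (hd w) a \<in> descend p M (tl w)}"

text \<open>\<open>push\<close> is applied to all starting points of \<open>w\<close> at once; they
  become matched, so none is left. The inclusion for other words allows treating words one after
  another without reviving earlier ones.\<close>

lemma augment_word:
  assumes M: "labelling k p M" and w: "length w = Suc k" "set w \<subseteq> S"
  shows "\<exists>M'. labelling k p M' \<and> augmenting p M' w = {} \<and>
     (\<forall>v. set v \<subseteq> S \<longrightarrow> v \<noteq> [] \<longrightarrow> augmenting p M' v \<subseteq> augmenting p M v)"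
proof -
  obtain s u where su: "w = s # u" using w by (cases w) auto
  define U where "U = augmenting p M w"
  have Mm: "matching M" "valid p M" and cl: "\<And>j. clopen_in X {b \<in> B. p b = j}"
    and free: "\<And>b. b \<in> B - Range M \<Longrightarrow> p b = 0"
    and low: "\<And>a b. (a, b) \<in> edges \<Longrightarrow> a \<notin> Domain M \<Longrightarrow> k \<le> p b" using M by (auto simp: labelling_def)
  have pw: "piecewise M" using Mm by (auto simp: matching_def)
  have "U = (A - Domain M) \<inter> {x \<in> topspace X. \<phi> s x \<in> descend p M u}"
    using clopen_subset[OF clopen_A] by (auto simp: U_def augmenting_def su)
  then have U: "clopen_in X U"
    using su w S_carrier cl
    by (auto intro!: clopen_Int clopen_Diff clopen_A clopen_Domain pw clopen_vimage clopen_descend)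
  have "U \<subseteq> A - Domain M" "s \<in> S" "set u \<subseteq> S" "\<phi> s ` U \<subseteq> descend p M u"
    using su w by (auto simp: U_def augmenting_def)
  \<comment> \<open>The lower bound \<open>k\<close> of the round is exactly the length of the tail,
    as \<open>push\<close> requires.\<close>
  moreover have "\<forall>a\<in>U. \<forall>b. (a, b) \<in> edges \<longrightarrow> length u \<le> p b"
    using low su w by (auto simp: U_def augmenting_def)
  ultimately obtain M' where M': "matching M'" "valid p M'" "Range M \<subseteq> Range M'" "Domain M' = Domain M \<union> U"
     "\<And>v. set v \<subseteq> S \<Longrightarrow> descend p M' v \<subseteq> descend p M v"
    using push[OF Mm cl U] by metis
  have "labelling k p M'" unfolding labelling_def using M' cl free low by blast
  moreover have mono: "augmenting p M' v \<subseteq> augmenting p M v" if "set v \<subseteq> S" "v \<noteq> []" for v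
    using M'(4) M'(5)[of "tl v"] that by (cases v) (auto simp: augmenting_def)
  moreover have "augmenting p M' w = {}"
    using mono[of w] w su M'(4) by (auto simp: augmenting_def U_def)
  ultimately show ?thesis by blast
qed

lemma augment_words:
  assumes "finite W" "W \<subseteq> {w. set w \<subseteq> S \<and> length w = Suc k}" "labelling k p M"
  shows "\<exists>M'. labelling k p M' \<and> (\<forall>w\<in>W. augmenting p M' w = {})"
  using assms(1,2)
proof (induction W rule: finite_induct)
  case empty
  then show ?case using assms(3) by auto
next
  case (insert w W)
  then obtain M1 where M1: "labelling k p M1" "\<forall>w\<in>W. augmenting p M1 w = {}" by auto
  then obtain M' where "labelling k p M'" "augmenting p M' w = {}"
     "\<forall>v. set v \<subseteq> S \<longrightarrow> v \<noteq> [] \<longrightarrow> augmenting p M' v \<subseteq> augmenting p M1 v"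
    using augment_word[OF M1(1), of w] insert.prems by auto
  moreover have "\<forall>v\<in>W. set v \<subseteq> S \<and> v \<noteq> []" using insert.prems by auto
  ultimately show ?case using M1(2) by (intro exI[of _ M']) blast
qed

text \<open>\<open>level M j\<close> consists of the points of \<open>B\<close> from which an alternating walk with \<open>j\<close>
  matched edges leads to a free point.\<close>

primrec level :: "('x \<times> 'x) set \<Rightarrow> nat \<Rightarrow> 'x set" where
  "level M 0 = B - Range M"
| "level M (Suc j) = M `` (edges\<inverse> `` level M j)"

lemma clopen_level: "piecewise M \<Longrightarrow> clopen_in X (level M j)"
  by (induction j)
    (auto intro!: clopen_Diff clopen_B clopen_Range clopen_Image clopen_converse_Image piecewise_edges)

lemma level_subset: "matching M \<Longrightarrow> level M j \<subseteq> B"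
  by (cases j) (auto simp: matching_def edges_iff subset_iff)

lemma level_label_le:
  assumes "labelling k p M" "b \<in> level M j"
  shows "p b \<le> j"
  using assms(2)
proof (induction j arbitrary: b)
  case 0
  then show ?case using assms(1) by (auto simp: labelling_def)
next
  case (Suc j)
  then obtain a b' where "(a, b) \<in> M" "(a, b') \<in> edges" "b' \<in> level M j" by auto
  then have "p b \<le> p b' + 1" "p b' \<le> j" using assms(1) Suc by (auto simp: labelling_def valid_def)
  then show ?case by simp
qed

text \<open>A label drops by at most one per matched edge. If it equals the number of steps to a
  free point, every step must drop it by exactly one, so the walk is descending.\<close>

lemma level_descend:
  assumes "labelling k p M" "b \<in> level M j" "p b = j"
  shows "\<exists>w. set w \<subseteq> S \<and> length w = j \<and> b \<in> descend p M w"
  using assms(2,3)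
proof (induction j arbitrary: b)
  case 0
  then show ?case by (intro exI[of _ "[]"]) auto
next
  case (Suc j)
  then obtain a b' where ab: "(a, b) \<in> M" "(a, b') \<in> edges" "b' \<in> level M j" by auto
  then have "p b \<le> p b' + 1" using assms(1) by (auto simp: labelling_def valid_def)
  moreover have "p b' \<le> j" using level_label_le[OF assms(1) ab(3)] .
  ultimately have "p b' = j" using Suc.prems by simp
  then obtain w where w: "set w \<subseteq> S" "length w = j" "b' \<in> descend p M w" using Suc.IH ab by blast
  obtain s where s: "s \<in> S" "b' = \<phi> s a" "a \<in> A" using ab(2) by (auto simp: edges_iff)
  have "b \<in> B" using level_subset[of M "Suc j"] Suc.prems assms(1) by (auto simp: labelling_def)
  then have "b \<in> descend p M (s # w)" using Suc.prems(2) w s ab(1) by auto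
  then show ?case using s w by (intro exI[of _ "s # w"]) auto
qed

text \<open>The new label is the distance to the free points, truncated at \<open>Suc k\<close>. A
  neighbour \<open>b\<close> of an unmatched point with \<open>q b \<le> k\<close> would satisfy
  \<open>k \<le> p b \<le> q b\<close>, so both labels equal \<open>k\<close>; a shortest walk from
  \<open>b\<close> would then be descending and yield an augmenting word of length
  \<open>Suc k\<close>, contrary to \<open>no\<close>.\<close>

lemma relabel:
  assumes M: "labelling k p M" and no: "\<And>w. set w \<subseteq> S \<Longrightarrow> length w = Suc k \<Longrightarrow> augmenting p M w = {}"
  shows "\<exists>q. labelling (Suc k) q M"
proof -
  \<comment> \<open>Truncation means that only the levels up to \<open>k\<close> are consulted, so
    each label class is built from finitely many clopen sets.\<close>
  define q where "q b = (if \<exists>j\<le>k. b \<in> level M j then LEAST j. b \<in> level M j else Suc k)" for b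
  have Mm: "matching M" "piecewise M" using M by (auto simp: labelling_def matching_def)
  have q_le: "q b \<le> j" if "b \<in> level M j" "j \<le> k" for b j
    using that by (auto simp: q_def Least_le)
  have q_level: "b \<in> level M (q b)" if "q b \<le> k" for b
    using that by (auto simp: q_def intro: LeastI split: if_splits)
  have q_ub: "q b \<le> Suc k" for b
  proof (cases "\<exists>j\<le>k. b \<in> level M j")
    case True
    then obtain j where "j \<le> k" "b \<in> level M j" by blast
    then show ?thesis using q_le[of b j] by simp
  qed (auto simp: q_def)
  have "valid q M" unfolding valid_def
  proof (intro allI impI)
    fix a b b' assume ab: "(a, b) \<in> M" "(a, b') \<in> edges"
    show "q b \<le> q b' + 1"
    proof (cases "Suc (q b') \<le> k")
      case True
      then have "b \<in> level M (Suc (q b'))" using q_level[of b'] ab by auto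
      then show ?thesis using q_le[OF _ True] by simp
    qed (use q_ub[of b] in simp)
  qed
  moreover have "clopen_in X {b \<in> B. q b = j}" for j
  proof -
    have le: "q b \<le> i \<longleftrightarrow> (\<exists>l\<le>i. b \<in> level M l)" if "i \<le> k" for b i
    proof
      assume "q b \<le> i"
      then show "\<exists>l\<le>i. b \<in> level M l" using q_level[of b] that by auto
    next
      assume "\<exists>l\<le>i. b \<in> level M l"
      then obtain l where "l \<le> i" "b \<in> level M l" by blast
      then show "q b \<le> i" using q_le[of b l] that by simp
    qed
    have cle: "clopen_in X {b \<in> B. q b \<le> i}" for i
    proof (cases "i \<le> k")
      case True
      then have "{b \<in> B. q b \<le> i} = (\<Union>l\<in>{..i}. level M l)"
        using le[OF True] level_subset[OF Mm(1)] by auto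
      then show ?thesis by (simp add: clopen_UN clopen_level Mm)
    next
      case False
      then have "{b \<in> B. q b \<le> i} = B" using order_trans[OF q_ub, of i] by auto
      then show ?thesis using clopen_B by simp
    qed
    show ?thesis
    proof (cases j)
      case 0
      then show ?thesis using cle[of 0] by simp
    next
      case (Suc i)
      then have "{b \<in> B. q b = j} = {b \<in> B. q b \<le> j} - {b \<in> B. q b \<le> i}" by auto
      then show ?thesis using cle by (simp add: clopen_Diff)
    qed
  qed
  moreover have "q b = 0" if "b \<in> B - Range M" for b
    using q_le[of b 0] that by simp
  moreover have "Suc k \<le> q b" if ab: "(a, b) \<in> edges" "a \<notin> Domain M" for a b
  proof (rule ccontr)
    assume "\<not> Suc k \<le> q b"
    then have j: "q b \<le> k" "b \<in> level M (q b)" using q_level by auto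
    have "k \<le> p b" using M ab by (auto simp: labelling_def)
    then have "q b = k" "p b = k" using level_label_le[OF M j(2)] j by auto
    then obtain w where w: "set w \<subseteq> S" "length w = k" "b \<in> descend p M w"
      using level_descend[OF M j(2)] by auto
    obtain s where "s \<in> S" "b = \<phi> s a" "a \<in> A" using ab by (auto simp: edges_iff)
    then show False using no[of "s # w"] w ab(2) by (auto simp: augmenting_def)
  qed
  ultimately show ?thesis unfolding labelling_def using Mm by blast
qed

text \<open>Zero labels and the empty matching start the induction. Each round exhausts the finitely
  many words of length \<open>Suc k\<close> and then recomputes the labels.\<close>

lemma labelling_exists: "\<exists>p M. labelling k p M"
proof (induction k)
  case 0
  have "{b \<in> B. 0 = (j::nat)} = (if j = 0 then B else {})" for j by auto
  then have "labelling 0 (\<lambda>_. 0) {}"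
    using clopen_B by (auto simp: labelling_def matching_def valid_def piecewise_empty clopen_empty)
  then show ?case by blast
next
  case (Suc k)
  then obtain p M where "labelling k p M" by blast
  moreover have "finite {w. set w \<subseteq> S \<and> length w = Suc k}"
    using finite_S by (rule finite_lists_length_eq)
  ultimately obtain M' where "labelling k p M'"
      "\<forall>w\<in>{w. set w \<subseteq> S \<and> length w = Suc k}. augmenting p M' w = {}"
    using augment_words by blast
  then show ?case using relabel[of k p M'] by blast
qed

text \<open>The pieces of \<open>M\<close> may overlap, so they are cut down by
  \<open>disjointed\<close>; the images are disjoint because \<open>M\<close> is injective.\<close>

lemma subequivalent_if_Domain:
  assumes "matching M" "Domain M = A"
  shows "subequivalent G X \<phi> A B"
proof -
  obtain T where T: "finite T"
    "\<And>g C. (g, C) \<in> T \<Longrightarrow> g \<in> carrier G \<and> clopen_in X C \<and> C \<subseteq> topspace X"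
    "\<And>a b. (a, b) \<in> M \<longleftrightarrow> (\<exists>g C. (g, C) \<in> T \<and> a \<in> C \<and> b = \<phi> g a)"
    using assms(1) unfolding matching_def by (elim conjE, elim piecewiseE) (rule that)
  obtain xs where xs: "set xs = T" using T(1) finite_list by blast
  define g where "g i = fst (xs ! i)" for i
  define C where "C i = snd (xs ! i)" for i
  let ?k = "length xs"
  have gC: "g i \<in> carrier G" "clopen_in X (C i)" "\<And>x. x \<in> C i \<Longrightarrow> (x, \<phi> (g i) x) \<in> M" if "i < ?k" for i
  proof -
    have *: "(g i, C i) \<in> T" using that xs by (auto simp: g_def C_def)
    then show "g i \<in> carrier G" "clopen_in X (C i)" using T(2) by auto
    show "(x, \<phi> (g i) x) \<in> M" if "x \<in> C i" for x using * that T(3) by blast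
  qed
  have DM: "Domain M = (\<Union>i\<in>{0..<?k}. C i)"
  proof (intro equalityI subsetI)
    fix a assume "a \<in> Domain M"
    then obtain h P where hP: "(h, P) \<in> set xs" "a \<in> P" using T(3) xs by blast
    then obtain i where "i < ?k" "xs ! i = (h, P)" by (auto simp: in_set_conv_nth)
    then show "a \<in> (\<Union>i\<in>{0..<?k}. C i)" using hP by (auto simp: C_def intro!: bexI[of _ i])
  next
    fix a assume "a \<in> (\<Union>i\<in>{0..<?k}. C i)"
    then obtain i where "i < ?k" "a \<in> C i" by auto
    then show "a \<in> Domain M" using gC(3)[of i a] by blast
  qed
  have cl: "clopen_in X (disjointed C i)" if "i < ?k" for i
    unfolding disjointed_def using that by (intro clopen_Diff gC clopen_UN) auto
  have in_M: "(x, \<phi> (g i) x) \<in> M" if "i < ?k" "x \<in> disjointed C i" for i x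
    using gC(3)[OF that(1)] that(2) disjointed_subset[of C i] by blast
  have disj: "disjoint_family_on (disjointed C) {..<?k}"
    by (rule disjoint_family_on_mono[OF _ disjoint_family_disjointed]) simp
  have "disjoint_family_on (\<lambda>i. \<phi> (g i) ` disjointed C i) {..<?k}"
    unfolding disjoint_family_on_def
  proof (intro ballI impI equals0I)
    fix i j z assume ij: "i \<in> {..<?k}" "j \<in> {..<?k}" "i \<noteq> j"
      "z \<in> \<phi> (g i) ` disjointed C i \<inter> \<phi> (g j) ` disjointed C j"
    then obtain x y where xy: "x \<in> disjointed C i" "y \<in> disjointed C j" "z = \<phi> (g i) x" "z = \<phi> (g j) y"
      by auto
    then have "(x, z) \<in> M" "(y, z) \<in> M"
      using in_M[of i x] in_M[of j y] ij by (simp_all only: lessThan_iff)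
    then have "x = y" using assms(1) unfolding matching_def single_valued_conv by blast
    then show False using disj ij xy unfolding disjoint_family_on_def by blast
  qed
  moreover have "\<phi> (g i) ` disjointed C i \<subseteq> B" if "i < ?k" for i
    using in_M[OF that] assms(1) by (auto simp: matching_def edges_iff subset_iff)
  moreover have "A = (\<Union>i<?k. disjointed C i)"
    using finite_UN_disjointed_eq[of C ?k] DM assms(2) by (simp add: atLeast0LessThan)
  ultimately show ?thesis
    unfolding subequivalent_def using cl disj gC(1) by blast
qed

end

section \<open>Expansion of finite sets from a window\<close>

context clopen_action
begin

text \<open>Double counting of pairs \<open>(f, y)\<close> with \<open>f \<in> F\<close> and
  \<open>y\<close> in the finite set \<open>Y\<close> of points that some element of
  \<open>F\<close> moves into \<open>L\<close>. Each \<open>f\<close> sends at least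
  \<open>card L\<close> points of \<open>Y\<close> into \<open>L\<close> and at most
  \<open>card N\<close> into \<open>B\<close>, while each \<open>y\<close> favours \<open>B\<close>
  by the window inequality.\<close>

lemma window_expansion:
  assumes F: "finite F" "F \<subseteq> carrier G"
    and window: "\<And>x. x \<in> topspace X \<Longrightarrow> card {f \<in> F. \<phi> f x \<in> A} < card {f \<in> F. \<phi> f x \<in> B}"
    and L: "finite L" "L \<subseteq> A" "L \<subseteq> topspace X"
    and N: "finite N" "\<And>f f' l. f \<in> F \<Longrightarrow> f' \<in> F \<Longrightarrow> l \<in> L \<Longrightarrow> \<phi> (f \<otimes> inv f') l \<in> B \<Longrightarrow> \<phi> (f \<otimes> inv f') l \<in> N"
  shows "(card F + 1) * card L \<le> card F * card N"
proof (cases "L = {}")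
  case False
  then obtain x0 where "x0 \<in> topspace X" using L by auto
  then have "F \<noteq> {}" using window by fastforce
  then have F0: "0 < card F" using F by (simp add: card_gt_0_iff)
  define Y where "Y = (\<Union>f\<in>F. \<phi> (inv f) ` L)"
  have Y: "finite Y" using F L by (simp add: Y_def)
  have YX: "Y \<subseteq> topspace X"
  proof
    fix y assume "y \<in> Y"
    then obtain f l where "f \<in> F" "l \<in> L" "y = \<phi> (inv f) l" by (auto simp: Y_def)
    then show "y \<in> topspace X" using element_image[of "inv f" l y] F L by auto
  qed
  have swap: "(\<Sum>y\<in>Y. card {f \<in> F. \<phi> f y \<in> C}) = (\<Sum>f\<in>F. card {y \<in> Y. \<phi> f y \<in> C})" for C
    by (rule sum_multicount_gen) (use Y F in auto)
  have "card L \<le> card {y \<in> Y. \<phi> f y \<in> L}" if f: "f \<in> F" for f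
  proof (rule card_inj_on_le)
    have fG: "f \<in> carrier G" using f F by auto
    show "inj_on (\<phi> (inv f)) L" by (rule inj_on_subset[OF inj_prop L(3)]) (simp add: fG)
    have "\<phi> f (\<phi> (inv f) l) = l" if "l \<in> L" for l
      using act_inv[of "inv f" l] fG that L(3) by auto
    then show "\<phi> (inv f) ` L \<subseteq> {y \<in> Y. \<phi> f y \<in> L}" using f by (auto simp: Y_def)
  qed (use Y in simp)
  then have "(\<Sum>f\<in>F. card L) \<le> (\<Sum>f\<in>F. card {y \<in> Y. \<phi> f y \<in> L})" by (rule sum_mono)
  then have 1: "card F * card L \<le> (\<Sum>y\<in>Y. card {f \<in> F. \<phi> f y \<in> L})" by (simp add: swap)
  have "card {y \<in> Y. \<phi> f y \<in> B} \<le> card N" if f: "f \<in> F" for f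
  proof (rule card_inj_on_le)
    have fG: "f \<in> carrier G" using f F by auto
    show "inj_on (\<phi> f) {y \<in> Y. \<phi> f y \<in> B}"
      by (rule inj_on_subset[OF inj_prop[OF fG]]) (use YX in auto)
    show "\<phi> f ` {y \<in> Y. \<phi> f y \<in> B} \<subseteq> N"
    proof
      fix z assume "z \<in> \<phi> f ` {y \<in> Y. \<phi> f y \<in> B}"
      then obtain f' l where l: "f' \<in> F" "l \<in> L" "z = \<phi> f (\<phi> (inv f') l)" "z \<in> B"
        by (auto simp: Y_def)
      then have "f' \<in> carrier G" "l \<in> topspace X" using F L by auto
      then have "z = \<phi> (f \<otimes> inv f') l" using composition_rule[of l f "inv f'"] fG l by simp
      then show "z \<in> N" using N(2)[OF f l(1,2)] l(4) by simp
    qed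
  qed (rule N)
  then have "(\<Sum>f\<in>F. card {y \<in> Y. \<phi> f y \<in> B}) \<le> (\<Sum>f\<in>F. card N)" by (rule sum_mono)
  then have 2: "(\<Sum>y\<in>Y. card {f \<in> F. \<phi> f y \<in> B}) \<le> card F * card N" by (simp add: swap)
  \<comment> \<open>The strict inequality between naturals leaves a gap of one, and the count for
    \<open>L\<close> is at most \<open>card F\<close>; so the additive gap becomes a factor
    \<open>1 + 1 / card F\<close>.\<close>
  have 3: "(card F + 1) * card {f \<in> F. \<phi> f y \<in> L} \<le> card F * card {f \<in> F. \<phi> f y \<in> B}" if "y \<in> Y" for y
  proof -
    have "card {f \<in> F. \<phi> f y \<in> L} \<le> card {f \<in> F. \<phi> f y \<in> A}"
      using L(2) F by (intro card_mono) auto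
    also have "\<dots> < card {f \<in> F. \<phi> f y \<in> B}" using window YX that by auto
    finally have "card F * (card {f \<in> F. \<phi> f y \<in> L} + 1) \<le> card F * card {f \<in> F. \<phi> f y \<in> B}"
      by (intro mult_le_mono2) simp
    moreover have "card {f \<in> F. \<phi> f y \<in> L} \<le> card F" using F by (intro card_mono) auto
    ultimately show ?thesis by (simp add: algebra_simps)
  qed
  have "(card F + 1) * (card F * card L) \<le> (card F + 1) * (\<Sum>y\<in>Y. card {f \<in> F. \<phi> f y \<in> L})"
    using 1 by (rule mult_le_mono2)
  also have "\<dots> \<le> card F * (\<Sum>y\<in>Y. card {f \<in> F. \<phi> f y \<in> B})"
    unfolding sum_distrib_left by (rule sum_mono[OF 3])
  also have "\<dots> \<le> card F * (card F * card N)" using 2 by (rule mult_le_mono2)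
  finally have "card F * ((card F + 1) * card L) \<le> card F * (card F * card N)"
    by (simp only: mult.left_commute)
  then show ?thesis using F0 by (simp only: mult_le_cancel1)
qed simp

end

section \<open>Spreading of alternating walks\<close>

context matching_problem
begin

lemma matching_expand:
  assumes M: "matching M" and N: "finite N" "N \<subseteq> Range M"
  shows "card N \<le> card (M\<inverse> `` N)" "finite (M\<inverse> `` N)"
proof -
  have sv: "single_valued M" "single_valued (M\<inverse>)" using M by (auto simp: matching_def)
  have "\<forall>b\<in>N. \<exists>a. (a, b) \<in> M" using N by blast
  then obtain h where h: "\<And>b. b \<in> N \<Longrightarrow> (h b, b) \<in> M" by metis
  have im: "M\<inverse> `` N = h ` N"
  proof (intro equalityI subsetI)
    fix a assume "a \<in> M\<inverse> `` N"
    then obtain b where "b \<in> N" "(a, b) \<in> M" by blast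
    then have "a = h b" using sv(2) h unfolding single_valued_conv by blast
    then show "a \<in> h ` N" using \<open>b \<in> N\<close> by blast
  qed (use h in blast)
  have "inj_on h N"
  proof (rule inj_onI)
    fix b b' assume "b \<in> N" "b' \<in> N" "h b = h b'"
    then have "(h b, b) \<in> M" "(h b, b') \<in> M" using h[of b] h[of b'] by simp_all
    then show "b = b'" using sv(1) by (auto simp: single_valued_def)
  qed
  then show "card N \<le> card (M\<inverse> `` N)" by (simp add: im card_image)
  show "finite (M\<inverse> `` N)" using N by (simp add: im)
qed

text \<open>\<open>L j\<close> collects the points of \<open>A\<close> reached from an unmatched
  \<open>a\<close> by \<open>j\<close> alternations. Up to \<open>j = k\<close> all neighbours met
  on the way are matched, so each step multiplies the size by at least \<open>c\<close>; yet
  \<open>L j\<close> lies in the image of \<open>a\<close> under the \<open>j\<close>-th power of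
  \<open>S <#> S\<close>, which is too small for \<open>j = k\<close>.\<close>

lemma labelling_covers:
  assumes lab: "labelling k p M"
    and S_inv: "\<And>s. s \<in> S \<Longrightarrow> inv s \<in> S"
    and expand: "\<And>L. finite L \<Longrightarrow> L \<subseteq> A \<Longrightarrow> c * real (card L) \<le> real (card (edges `` L))"
    and growth: "real (card (set_power G (S <#> S) k)) < c ^ k" and c: "0 \<le> c"
  shows "A \<subseteq> Domain M"
proof (rule ccontr)
  assume "\<not> A \<subseteq> Domain M"
  then obtain a where a: "a \<in> A" "a \<notin> Domain M" by blast
  have M: "matching M" "M \<subseteq> edges" and val: "valid p M"
    and free: "\<And>b. b \<in> B - Range M \<Longrightarrow> p b = 0"
    and low: "\<And>a b. (a, b) \<in> edges \<Longrightarrow> a \<notin> Domain M \<Longrightarrow> k \<le> p b"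
    using lab by (auto simp: labelling_def matching_def)
  have AX: "A \<subseteq> topspace X" by (rule clopen_subset[OF clopen_A])
  define S2 where "S2 = S <#> S"
  have S2: "finite S2" "S2 \<subseteq> carrier G"
    unfolding S2_def using finite_set_mult[OF finite_S finite_S] set_mult_closed[OF S_carrier S_carrier] by auto
  have finite_edges: "finite (edges `` L)" if "finite L" for L
  proof (rule finite_subset)
    show "edges `` L \<subseteq> (\<Union>s\<in>S. \<phi> s ` L)" by (fastforce simp: edges_iff)
  qed (use finite_S that in simp)
  define L where "L = rec_nat {a} (\<lambda>_ L. M\<inverse> `` (edges `` L))"
  have L0: "L 0 = {a}" and LS: "L (Suc j) = M\<inverse> `` (edges `` L j)" for j by (simp_all add: L_def)
  have main: "finite (L j) \<and> L j \<subseteq> A \<and> c ^ j \<le> real (card (L j)) \<and>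
      L j \<subseteq> (\<lambda>u. \<phi> u a) ` set_power G S2 j \<and> (\<forall>l\<in>L j. \<forall>b. (l, b) \<in> edges \<longrightarrow> k \<le> p b + j)" if "j \<le> k" for j
    using that
  proof (induction j)
    case 0
    have "\<phi> \<one> a = a" using a AX id_eq_one by (metis restrict_apply' subsetD)
    then show ?case using a low by (simp add: L0)
  next
    case (Suc j)
    then have IH: "finite (L j)" "L j \<subseteq> A" "c ^ j \<le> real (card (L j))"
      "L j \<subseteq> (\<lambda>u. \<phi> u a) ` set_power G S2 j" "\<And>l b. l \<in> L j \<Longrightarrow> (l, b) \<in> edges \<Longrightarrow> k \<le> p b + j"
      by auto
    \<comment> \<open>Here \<open>j < k\<close>, so every neighbour has a positive label and cannot
      be free.\<close>
    have R: "edges `` L j \<subseteq> Range M"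
    proof
      fix b assume "b \<in> edges `` L j"
      then have "b \<in> B" "k \<le> p b + j" using IH(5) by (auto simp: edges_iff)
      then show "b \<in> Range M" using free[of b] Suc.prems by (cases "b \<in> Range M") auto
    qed
    note ex = matching_expand[OF M(1) finite_edges[OF IH(1)] R, folded LS]
    have "c ^ Suc j \<le> c * real (card (L j))" using IH(3) c by (simp add: mult_left_mono)
    also have "\<dots> \<le> real (card (edges `` L j))" by (rule expand[OF IH(1,2)])
    also have "\<dots> \<le> real (card (L (Suc j)))" using ex(1) by simp
    finally have 1: "c ^ Suc j \<le> real (card (L (Suc j)))" .
    have 2: "L (Suc j) \<subseteq> A" unfolding LS using M(2) by (auto simp: edges_iff subset_iff)
    have 3: "L (Suc j) \<subseteq> (\<lambda>u. \<phi> u a) ` set_power G S2 (Suc j)"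
    proof
      fix l' assume l': "l' \<in> L (Suc j)"
      then obtain l b where lb: "l \<in> L j" "(l, b) \<in> edges" "(l', b) \<in> M" unfolding LS by blast
      obtain s where s: "s \<in> S" "b = \<phi> s l" using lb(2) by (auto simp: edges_iff)
      have "(l', b) \<in> edges" using lb M by auto
      then obtain t where t: "t \<in> S" "b = \<phi> t l'" by (auto simp: edges_iff)
      obtain u where u: "u \<in> set_power G S2 j" "l = \<phi> u a" using IH(4) lb by blast
      have G: "s \<in> carrier G" "t \<in> carrier G" "u \<in> carrier G"
        using s t u S_carrier set_power_closed[OF S2(2), of j] by auto
      have X: "a \<in> topspace X" "l \<in> topspace X" "l' \<in> topspace X" using a AX lb IH(2) 2 l' by auto
      \<comment> \<open>Going out by \<open>s\<close> and back by \<open>t\<close> amounts to one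
        letter \<open>inv t \<otimes> s\<close> of \<open>S <#> S\<close>, since \<open>S\<close> is
        closed under inverses; it is prepended to \<open>u\<close>.\<close>
      have "l' = \<phi> (inv t) (\<phi> s l)" using act_inv[of t l'] G X s t by simp
      also have "\<dots> = \<phi> (inv t \<otimes> s) (\<phi> u a)" using composition_rule[of l "inv t" s] G X u by simp
      also have "\<dots> = \<phi> ((inv t \<otimes> s) \<otimes> u) a" using composition_rule[of a "inv t \<otimes> s" u] G X by simp
      finally have "l' = \<phi> ((inv t \<otimes> s) \<otimes> u) a" .
      moreover have "inv t \<otimes> s \<in> S2" using S_inv t s by (auto simp: S2_def set_mult_def)
      then have "(inv t \<otimes> s) \<otimes> u \<in> set_power G S2 (Suc j)"
        unfolding set_power_Suc_left[OF S2(2)] using u by (auto simp: set_mult_def)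
      ultimately show "l' \<in> (\<lambda>u. \<phi> u a) ` set_power G S2 (Suc j)" by blast
    qed
    have 4: "k \<le> p b + Suc j" if l': "l' \<in> L (Suc j)" "(l', b) \<in> edges" for l' b
    proof -
      obtain l b0 where lb: "l \<in> L j" "(l, b0) \<in> edges" "(l', b0) \<in> M" using l'(1) unfolding LS by blast
      then have "k \<le> p b0 + j" using IH(5) by blast
      moreover have "p b0 \<le> p b + 1" using val lb(3) l'(2) by (auto simp: valid_def)
      ultimately show ?thesis by simp
    qed
    show ?case using ex(2) 1 2 3 4 by blast
  qed
  have "c ^ k \<le> real (card (L k))" "L k \<subseteq> (\<lambda>u. \<phi> u a) ` set_power G S2 k" using main[of k] by auto
  moreover have "card (L k) \<le> card (set_power G S2 k)"
    using calculation(2) finite_set_power[OF S2(1)] by (rule surj_card_le[rotated])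
  ultimately show False using growth by (simp add: S2_def)
qed

end

section \<open>Subequivalence from a window\<close>

context clopen_action
begin

text \<open>\<open>S\<close> consists of the quotients of elements of \<open>F\<close>: it is
  symmetric, and \<open>window_expansion\<close> gives expansion by
  \<open>c = 1 + 1 / card F\<close>. The number \<open>k\<close> of rounds is chosen by comparing
  the growth of \<open>S <#> S\<close> with this \<open>c\<close>.\<close>

lemma subequivalent_if_window:
  assumes A: "clopen_in X A" and B: "clopen_in X B"
    and F: "finite F" "F \<subseteq> carrier G"
    and window: "\<And>x. x \<in> topspace X \<Longrightarrow> card {f \<in> F. \<phi> f x \<in> A} < card {f \<in> F. \<phi> f x \<in> B}"
    and growth: "\<And>S c. finite S \<Longrightarrow> S \<subseteq> carrier G \<Longrightarrow> 1 < c \<Longrightarrow> \<exists>n. real (card (set_power G S n)) < c ^ n"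
  shows "subequivalent G X \<phi> A B"
proof -
  define S where "S = (\<lambda>(f, f'). f \<otimes> inv f') ` (F \<times> F)"
  have S: "finite S" "S \<subseteq> carrier G" using F by (auto simp: S_def subset_iff)
  interpret mp: matching_problem G X \<phi> A B S
    by unfold_locales (use A B S in auto)
  have S_inv: "inv s \<in> S" if s: "s \<in> S" for s
  proof -
    obtain f f' where f: "f \<in> F" "f' \<in> F" "s = f \<otimes> inv f'" using s by (auto simp: S_def)
    moreover have "f \<in> carrier G" "f' \<in> carrier G" using f F by auto
    ultimately have "inv s = f' \<otimes> inv f" by (simp add: inv_mult_group)
    then show ?thesis using f by (auto simp: S_def)
  qed
  have AX: "A \<subseteq> topspace X" by (rule clopen_subset[OF A])
  have expand: "(card F + 1) * card L \<le> card F * card (mp.edges `` L)" if L: "finite L" "L \<subseteq> A" for L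
  proof (rule window_expansion[OF F window L])
    show "L \<subseteq> topspace X" using L AX by blast
    have "mp.edges `` L \<subseteq> (\<Union>s\<in>S. \<phi> s ` L)" by (fastforce simp: mp.edges_iff)
    then show "finite (mp.edges `` L)" using S(1) L(1) by (meson finite_UN_I finite_imageI finite_subset)
    show "\<phi> (f \<otimes> inv f') l \<in> mp.edges `` L" if "f \<in> F" "f' \<in> F" "l \<in> L" "\<phi> (f \<otimes> inv f') l \<in> B" for f f' l
    proof -
      have "f \<otimes> inv f' \<in> S" using that by (auto simp: S_def)
      then have "(l, \<phi> (f \<otimes> inv f') l) \<in> mp.edges" using that L by (auto simp: mp.edges_iff)
      then show ?thesis using that by blast
    qed
  qed
  show ?thesis
  proof (cases "F = {}")
    case True
    \<comment> \<open>An empty window would demand \<open>0 < 0\<close> at every point.\<close>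
    then have "topspace X = {}" using window by fastforce
    then have "A = {}" using AX by blast
    moreover have "mp.matching {}" by (simp add: mp.matching_def piecewise_empty)
    ultimately show ?thesis using mp.subequivalent_if_Domain[of "{}"] by simp
  next
    case False
    then have F0: "0 < card F" using F by (simp add: card_gt_0_iff)
    define c where "c = (real (card F) + 1) / real (card F)"
    have c: "1 < c" using F0 by (simp add: c_def)
    have exp_c: "c * real (card L) \<le> real (card (mp.edges `` L))" if "finite L" "L \<subseteq> A" for L
    proof -
      have "real ((card F + 1) * card L) \<le> real (card F * card (mp.edges `` L))"
        using expand[OF that] by (rule of_nat_mono)
      then show ?thesis using F0 by (simp add: c_def field_simps)
    qed
    have "finite (S <#> S)" "S <#> S \<subseteq> carrier G"
      using S finite_set_mult set_mult_closed by auto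
    then obtain k where k: "real (card (set_power G (S <#> S) k)) < c ^ k" using growth c by blast
    obtain p M where M: "mp.labelling k p M" using mp.labelling_exists by blast
    have "A \<subseteq> Domain M"
      by (rule mp.labelling_covers[OF M S_inv exp_c k]) (use c in auto)
    moreover have "mp.matching M" using M by (simp add: mp.labelling_def)
    moreover from this have "Domain M \<subseteq> A" by (auto simp: mp.matching_def mp.edges_iff)
    ultimately show ?thesis using mp.subequivalent_if_Domain by blast
  qed
qed

end


section \<open>Windows from invariant measures\<close>

lemma compact_closed_nest:
  fixes Q :: "nat \<Rightarrow> 'a::topological_space set"
  assumes "compact K" "\<And>n. closed (Q n)" "\<And>n. Q n \<subseteq> K" "\<And>n. Q n \<noteq> {}" "decseq Q"
  shows "(\<Inter>n. Q n) \<noteq> {}"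
proof -
  have "K \<inter> (\<Inter>n\<in>UNIV. Q n) \<noteq> {}"
  proof (rule compact_imp_fip_image[OF assms(1)])
    fix I :: "nat set" assume I: "finite I"
    have "Q (Max (insert 0 I)) \<subseteq> Q i" if "i \<in> I" for i
      using assms(5) I that by (auto simp: decseq_def)
    then have "Q (Max (insert 0 I)) \<subseteq> K \<inter> (\<Inter>i\<in>I. Q i)" using assms(3) by blast
    then show "K \<inter> (\<Inter>i\<in>I. Q i) \<noteq> {}" using assms(4) by blast
  qed (use assms(2) in auto)
  then show ?thesis by blast
qed

text \<open>Tychonoff's theorem; functions carry the topology of pointwise convergence.\<close>

lemma compact_function_box: "compact {m :: 'a \<Rightarrow> real. \<forall>C. m C \<in> {0..1}}"
proof -
  have "compactin (product_topology (\<lambda>_::'a. euclidean :: real topology) UNIV) (PiE UNIV (\<lambda>_. {0..1}))"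
    unfolding compactin_PiE by simp
  moreover have "PiE UNIV (\<lambda>_. {0..1}) = {m :: 'a \<Rightarrow> real. \<forall>C. m C \<in> {0..1}}"
    by (auto simp: PiE_def extensional_def)
  ultimately show ?thesis unfolding euclidean_product_topology by simp
qed

text \<open>An open set in a metrizable space is a countable union of closed sets. Each of these is
  compact, hence covered by finitely many clopen subsets of \<open>U\<close>. This makes the clopen
  sets generate the Borel sets.\<close>

lemma openin_countable_Union_clopen:
  assumes X: "metrizable_space X" "compact_space X" "X dim_le 0" and U: "openin X U"
  shows "\<exists>\<C>. countable \<C> \<and> (\<forall>C\<in>\<C>. clopen_in X C) \<and> \<Union>\<C> = U"
proof -
  have "fsigma_in X U" using X(1) U by (rule open_imp_fsigma_in)
  then obtain \<K> where K: "countable \<K>" "\<And>K. K \<in> \<K> \<Longrightarrow> closedin X K" "\<Union>\<K> = U"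
    unfolding fsigma_in_def union_of_def by blast
  have base: "\<exists>C. clopen_in X C \<and> x \<in> C \<and> C \<subseteq> U" if "x \<in> U" for x
    using X(3) U that
    unfolding dimension_le_0_neighbourhood_base_of_clopen neighbourhood_base_of clopen_in_def
    by (meson subsetD)
  have "\<forall>K\<in>\<K>. \<exists>\<F>. finite \<F> \<and> (\<forall>C\<in>\<F>. clopen_in X C) \<and> K \<subseteq> \<Union>\<F> \<and> \<Union>\<F> \<subseteq> U"
  proof
    fix K assume that: "K \<in> \<K>"
    have "K \<subseteq> \<Union>{C. clopen_in X C \<and> C \<subseteq> U}"
    proof
      fix x assume "x \<in> K"
      then have "x \<in> U" using K(3) that by blast
      from base[OF this] show "x \<in> \<Union>{C. clopen_in X C \<and> C \<subseteq> U}" by blast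
    qed
    then have "\<exists>\<F>. finite \<F> \<and> \<F> \<subseteq> {C. clopen_in X C \<and> C \<subseteq> U} \<and> K \<subseteq> \<Union>\<F>"
      by (intro compactinD[OF closedin_compact_space[OF X(2) K(2)[OF that]]]) (simp_all add: clopen_in_def)
    then obtain \<F> where "finite \<F>" "\<F> \<subseteq> {C. clopen_in X C \<and> C \<subseteq> U}" "K \<subseteq> \<Union>\<F>" by (elim exE conjE)
    then show "\<exists>\<F>. finite \<F> \<and> (\<forall>C\<in>\<F>. clopen_in X C) \<and> K \<subseteq> \<Union>\<F> \<and> \<Union>\<F> \<subseteq> U"
      by (intro exI[of _ \<F>]) blast
  qed
  from bchoice[OF this] obtain \<F> where
    "\<forall>K\<in>\<K>. finite (\<F> K) \<and> (\<forall>C\<in>\<F> K. clopen_in X C) \<and> K \<subseteq> \<Union>(\<F> K) \<and> \<Union>(\<F> K) \<subseteq> U" ..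
  then have F: "\<And>K. K \<in> \<K> \<Longrightarrow> finite (\<F> K)" "\<And>K C. K \<in> \<K> \<Longrightarrow> C \<in> \<F> K \<Longrightarrow> clopen_in X C"
    "\<And>K. K \<in> \<K> \<Longrightarrow> K \<subseteq> \<Union>(\<F> K)" "\<And>K. K \<in> \<K> \<Longrightarrow> \<Union>(\<F> K) \<subseteq> U"
    by simp_all
  have "countable (\<Union>K\<in>\<K>. \<F> K)" using K(1) F(1) by (simp add: countable_finite)
  moreover have "\<Union>(\<Union>K\<in>\<K>. \<F> K) = U"
  proof (intro equalityI subsetI)
    fix x assume "x \<in> \<Union>(\<Union>K\<in>\<K>. \<F> K)"
    then show "x \<in> U" using F(4) by blast
  next
    fix x assume "x \<in> U"
    then obtain K where "K \<in> \<K>" "x \<in> K" using K(3) by blast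
    then show "x \<in> \<Union>(\<Union>K\<in>\<K>. \<F> K)" using F(3)[of K] by blast
  qed
  moreover have "\<forall>C\<in>(\<Union>K\<in>\<K>. \<F> K). clopen_in X C" using F(2) by blast
  ultimately show ?thesis by blast
qed

section \<open>From clopen contents to invariant measures and windows\<close>

context clopen_action
begin

text \<open>Caratheodory extension from the algebra of clopen sets: continuity at the empty set is
  automatic by compactness. Invariance passes to all Borel sets because the clopen sets form an
  intersection-stable generator.\<close>

lemma measure_from_clopen_content:
  assumes X: "zero_dim_compact_metric_space X"
    and m0: "\<And>C. 0 \<le> m C" and m1: "m (topspace X) = (1::real)"
    and add: "\<And>C D. clopen_in X C \<Longrightarrow> clopen_in X D \<Longrightarrow> C \<inter> D = {} \<Longrightarrow> m (C \<union> D) = m C + m D"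
    and m_inv: "\<And>g C. g \<in> carrier G \<Longrightarrow> clopen_in X C \<Longrightarrow> m (\<phi> g ` C) = m C"
  shows "\<exists>\<mu>. invariant_borel_prob G X \<phi> \<mu> \<and> (\<forall>C. clopen_in X C \<longrightarrow> measure \<mu> C = m C)"
proof -
  let ?\<Omega> = "topspace X"
  define \<C> where "\<C> = {C. clopen_in X C}"
  have C_iff: "C \<in> \<C> \<longleftrightarrow> clopen_in X C" for C by (simp add: \<C>_def)
  have CP: "\<C> \<subseteq> Pow ?\<Omega>" using clopen_subset by (auto simp: \<C>_def)
  interpret algebra ?\<Omega> \<C>
    using CP clopen_empty clopen_Un clopen_Diff[OF clopen_topspace] by (auto simp: algebra_iff_Un C_iff)
  have m_empty: "m {} = 0" using add[OF clopen_empty clopen_empty] by simp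
  have "\<exists>\<nu>::'x set \<Rightarrow> ennreal. (\<forall>C\<in>\<C>. \<nu> C = ennreal (m C)) \<and> measure_space ?\<Omega> (sigma_sets ?\<Omega> \<C>) \<nu>"
  proof (rule caratheodory_empty_continuous)
    show "positive \<C> (\<lambda>C. ennreal (m C))" by (simp add: positive_def m_empty)
    show "additive \<C> (\<lambda>C. ennreal (m C))"
      unfolding additive_def
    proof (intro ballI impI)
      fix C D assume "C \<in> \<C>" "D \<in> \<C>" "C \<inter> D = {}"
      then have "m (C \<union> D) = m C + m D" using add by (simp add: C_iff)
      then show "ennreal (m (C \<union> D)) = ennreal (m C) + ennreal (m D)"
        using m0[of C] m0[of D] by simp
    qed
    fix D :: "nat \<Rightarrow> 'x set" assume D: "range D \<subseteq> \<C>" "decseq D" "(\<Inter>i. D i) = {}"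
    \<comment> \<open>Decreasing nonempty closed sets in a compact space have a common point, so
      here the sequence must reach the empty set.\<close>
    have "\<exists>n. D n = {}"
    proof (rule ccontr)
      assume "\<nexists>n. D n = {}"
      then have "(\<Inter>i. D i) \<noteq> {}"
        using X D by (intro compact_space_imp_nest[of X])
          (auto simp: zero_dim_compact_metric_space_def \<C>_def clopen_in_def)
      then show False using D(3) by simp
    qed
    then obtain n where n: "D n = {}" ..
    have "D i = {}" if "n \<le> i" for i using decseqD[OF D(2) that] n by simp
    then have "eventually (\<lambda>i. ennreal (m (D i)) = 0) sequentially"
      unfolding eventually_sequentially using m_empty by (intro exI[of _ n]) simp
    then show "(\<lambda>i. ennreal (m (D i))) \<longlonglongrightarrow> 0" by (rule tendsto_eventually)
  qed simp
  then obtain \<nu> :: "'x set \<Rightarrow> ennreal" where "\<forall>C\<in>\<C>. \<nu> C = ennreal (m C)"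
    and ms: "measure_space ?\<Omega> (sigma_sets ?\<Omega> \<C>) \<nu>" by blast
  then have \<nu>: "\<nu> C = ennreal (m C)" if "clopen_in X C" for C using that by (simp add: C_iff)
  define \<mu> where "\<mu> = measure_of ?\<Omega> (sigma_sets ?\<Omega> \<C>) \<nu>"
  have sa: "sigma_algebra ?\<Omega> (sigma_sets ?\<Omega> \<C>)" using CP by (rule sigma_algebra_sigma_sets)
  have sets: "sets \<mu> = sigma_sets ?\<Omega> \<C>" and space: "space \<mu> = ?\<Omega>"
    unfolding \<mu>_def using sa by (simp_all add: sigma_algebra.sets_measure_of_eq sigma_algebra.space_measure_of_eq)
  have em: "emeasure \<mu> E = \<nu> E" if "E \<in> sigma_sets ?\<Omega> \<C>" for E
    unfolding \<mu>_def using ms that by (intro emeasure_measure_of_sigma) (auto simp: measure_space_def)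
  have emC: "emeasure \<mu> C = ennreal (m C)" if "clopen_in X C" for C
    using em[of C] \<nu>[OF that] that by (auto simp: C_iff)
  have prob: "prob_space \<mu>"
    by (rule prob_spaceI) (simp add: space emC clopen_topspace m1)
  have borel: "sigma_sets ?\<Omega> \<C> = sigma_sets ?\<Omega> {U. openin X U}"
  proof (rule sigma_sets_eqI)
    fix C assume "C \<in> \<C>"
    then show "C \<in> sigma_sets ?\<Omega> {U. openin X U}" by (auto simp: C_iff clopen_in_def)
  next
    fix U assume "U \<in> {U. openin X U}"
    then obtain \<D> where D: "countable \<D>" "\<forall>C\<in>\<D>. clopen_in X C" "\<Union>\<D> = U"
      using openin_countable_Union_clopen[of X U] X by (auto simp: zero_dim_compact_metric_space_def)
    then have "\<D> \<subseteq> sigma_sets ?\<Omega> \<C>" by (auto simp: C_iff)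
    then show "U \<in> sigma_sets ?\<Omega> \<C>" using sigma_algebra.countable_Union[OF sa D(1)] D(3) by simp
  qed
  have inv: "measure \<mu> (\<phi> g ` E) = measure \<mu> E" if g: "g \<in> carrier G" and E: "E \<in> sets \<mu>" for g E
  proof -
    \<comment> \<open>Images under \<open>\<phi> g\<close> become preimages under
      \<open>\<phi> (inv g)\<close>, the form that measurability and \<open>distr\<close>
      use.\<close>
    have pre: "\<phi> (inv g) -` D \<inter> ?\<Omega> = \<phi> g ` D" if D: "D \<subseteq> ?\<Omega>" for D
    proof (intro equalityI subsetI)
      fix x assume "x \<in> \<phi> (inv g) -` D \<inter> ?\<Omega>"
      then show "x \<in> \<phi> g ` D" using act_inv[of "inv g" x] g by (auto intro!: image_eqI[of x "\<phi> g" "\<phi> (inv g) x"])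
    next
      fix x assume "x \<in> \<phi> g ` D"
      then obtain d where "d \<in> D" "x = \<phi> g d" by blast
      then show "x \<in> \<phi> (inv g) -` D \<inter> ?\<Omega>"
        using act_inv[OF g, of d] element_image[OF g, of d x] D by auto
    qed
    have meas: "\<phi> (inv g) \<in> measurable \<mu> \<mu>"
    proof (rule measurable_sigma_sets[OF sets CP])
      show "\<phi> (inv g) \<in> space \<mu> \<rightarrow> ?\<Omega>" using g element_image[of "inv g"] by (auto simp: space)
      fix C assume "C \<in> \<C>"
      then have "clopen_in X C" by (simp add: C_iff)
      then show "\<phi> (inv g) -` C \<inter> space \<mu> \<in> sets \<mu>"
        using clopen_image[OF g] clopen_subset pre by (auto simp: space sets C_iff)
    qed
    have "distr \<mu> \<mu> (\<phi> (inv g)) = \<mu>"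
    proof (rule measure_eqI_generator_eq[of \<C> ?\<Omega> _ _ "\<lambda>_. ?\<Omega>"])
      show "Int_stable \<C>" using clopen_Int by (auto simp: Int_stable_def C_iff)
      fix C assume "C \<in> \<C>"
      then have C: "clopen_in X C" by (simp add: C_iff)
      then have "emeasure (distr \<mu> \<mu> (\<phi> (inv g))) C = emeasure \<mu> (\<phi> g ` C)"
        using meas by (subst emeasure_distr) (auto simp: space sets C_iff pre clopen_subset)
      also have "\<dots> = emeasure \<mu> C" using C m_inv[OF g C] clopen_image[OF g C] by (simp add: emC)
      finally show "emeasure (distr \<mu> \<mu> (\<phi> (inv g))) C = emeasure \<mu> C" .
    next
      show "emeasure (distr \<mu> \<mu> (\<phi> (inv g))) ?\<Omega> \<noteq> \<infinity>"
        using meas by (subst emeasure_distr) (auto simp: sets C_iff clopen_topspace prob_space.emeasure_space_1[OF prob]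
            finite_measure.emeasure_finite[OF prob_space.finite_measure[OF prob]])
    qed (use CP sets clopen_topspace in \<open>auto simp: C_iff\<close>)
    then have "measure \<mu> E = measure (distr \<mu> \<mu> (\<phi> (inv g))) E" by simp
    also have "\<dots> = measure \<mu> (\<phi> (inv g) -` E \<inter> space \<mu>)" by (rule measure_distr[OF meas E])
    also have "\<dots> = measure \<mu> (\<phi> g ` E)" using pre[of E] sets.sets_into_space[OF E] by (simp add: space)
    finally show ?thesis by simp
  qed
  have "invariant_borel_prob G X \<phi> \<mu>"
    unfolding invariant_borel_prob_def using prob space sets borel inv by simp
  moreover have "measure \<mu> C = m C" if "clopen_in X C" for C
    using emC[OF that] m0 by (simp add: measure_def)
  ultimately show ?thesis by blast
qed

text \<open>The invariance inequality is one-sided; for a content invariant under all of \<open>G\<close> the converse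
  follows by applying it to inverses.\<close>

definition almost_invariant :: "'x set \<Rightarrow> 'x set \<Rightarrow> 'g set \<Rightarrow> real \<Rightarrow> ('x set \<Rightarrow> real) set" where
  "almost_invariant A B K e = {m. (\<forall>C. m C \<in> {0..1}) \<and> m (topspace X) = 1 \<and>
     (\<forall>C D. clopen_in X C \<and> clopen_in X D \<and> C \<inter> D = {} \<longrightarrow> m (C \<union> D) = m C + m D) \<and>
     m B \<le> m A \<and> (\<forall>g\<in>K. \<forall>C. clopen_in X C \<longrightarrow> m C \<le> m (\<phi> g ` C) + e)}"

lemma almost_invariant_mono:
  assumes "K \<subseteq> K'" "e' \<le> e" shows "almost_invariant A B K' e' \<subseteq> almost_invariant A B K e"
proof
  fix m assume m: "m \<in> almost_invariant A B K' e'"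
  have "m C \<le> m (\<phi> g ` C) + e" if "g \<in> K" "clopen_in X C" for g C
  proof -
    have "m C \<le> m (\<phi> g ` C) + e'" using m that assms(1) unfolding almost_invariant_def by blast
    then show ?thesis using assms(2) by linarith
  qed
  then show "m \<in> almost_invariant A B K e" using m unfolding almost_invariant_def by blast
qed

text \<open>Every condition compares finitely many coordinates of \<open>m\<close> by an equality or
  a weak inequality, hence survives pointwise limits.\<close>

lemma closed_almost_invariant: "closed (almost_invariant A B K e)"
proof -
  have *: "continuous_on UNIV (\<lambda>m::'x set \<Rightarrow> real. m C)" for C by simp
  show ?thesis
    unfolding almost_invariant_def Ball_def atLeastAtMost_iff
    by (intro closed_Collect_conj closed_Collect_all closed_Collect_imp closed_Collect_le closed_Collect_eq
        continuous_intros * open_Collect_const)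
qed

text \<open>The witness is the visit frequency along a Folner set \<open>F\<close> of a point that
  \<open>bad\<close> supplies for \<open>F\<close>.\<close>

lemma almost_invariant_nonempty:
  assumes G: "subexponential_group G" and K: "finite K" "K \<subseteq> carrier G" and e: "0 < e"
    and bad: "\<And>F. finite F \<Longrightarrow> F \<subseteq> carrier G \<Longrightarrow>
      \<exists>x\<in>topspace X. card {f \<in> F. \<phi> f x \<in> B} \<le> card {f \<in> F. \<phi> f x \<in> A}"
  shows "almost_invariant A B K e \<noteq> {}"
proof -
  obtain F F' where F: "finite F'" "F \<noteq> {}" "F \<subseteq> F'" "F' \<subseteq> carrier G"
    "\<And>g f. g \<in> K \<Longrightarrow> f \<in> F \<Longrightarrow> g \<otimes> f \<in> F'" "real (card F') \<le> (1 + e) * real (card F)"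
    using folner[OF G K e] by blast
  have finF: "finite F" using F finite_subset by blast
  then have F0: "0 < card F" using F by (simp add: card_gt_0_iff)
  obtain x where x: "x \<in> topspace X" "card {f \<in> F. \<phi> f x \<in> B} \<le> card {f \<in> F. \<phi> f x \<in> A}"
    using bad[OF finF] F by blast
  define m where "m C = real (card {f \<in> F. \<phi> f x \<in> C}) / real (card F)" for C
  have "m C \<in> {0..1}" for C
    using card_mono[OF finF, of "{f \<in> F. \<phi> f x \<in> C}"] F0 by (simp add: m_def)
  moreover have "{f \<in> F. \<phi> f x \<in> topspace X} = F"
    using element_image[OF _ x(1)] F by blast
  then have "m (topspace X) = 1" using F0 by (simp add: m_def)
  moreover have "m (C \<union> D) = m C + m D" if "C \<inter> D = {}" for C D
  proof -
    have "{f \<in> F. \<phi> f x \<in> C \<union> D} = {f \<in> F. \<phi> f x \<in> C} \<union> {f \<in> F. \<phi> f x \<in> D}" by auto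
    moreover have "{f \<in> F. \<phi> f x \<in> C} \<inter> {f \<in> F. \<phi> f x \<in> D} = {}" using that by auto
    ultimately have "card {f \<in> F. \<phi> f x \<in> C \<union> D} = card {f \<in> F. \<phi> f x \<in> C} + card {f \<in> F. \<phi> f x \<in> D}"
      using finF by (simp add: card_Un_disjoint)
    then show ?thesis by (simp add: m_def add_divide_distrib)
  qed
  moreover have "m B \<le> m A" using x(2) by (simp add: m_def divide_right_mono)
  moreover have "m C \<le> m (\<phi> g ` C) + e" if g: "g \<in> K" for g C
  proof -
    have gG: "g \<in> carrier G" using g K by auto
    \<comment> \<open>Left multiplication by \<open>g\<close> turns visits to \<open>C\<close> into
      visits to its translate, except for products that leave \<open>F\<close>; these lie in
      \<open>F' - F\<close>, which has at most \<open>e * card F\<close> elements.\<close>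
    have "card {f \<in> F. \<phi> f x \<in> C} \<le> card ({f \<in> F. \<phi> f x \<in> \<phi> g ` C} \<union> (F' - F))"
    proof (rule card_inj_on_le)
      show "inj_on (\<lambda>f. g \<otimes> f) {f \<in> F. \<phi> f x \<in> C}"
        using F gG by (intro inj_onI) (auto simp: subset_iff)
      show "(\<lambda>f. g \<otimes> f) ` {f \<in> F. \<phi> f x \<in> C} \<subseteq> {f \<in> F. \<phi> f x \<in> \<phi> g ` C} \<union> (F' - F)"
      proof
        fix h assume "h \<in> (\<lambda>f. g \<otimes> f) ` {f \<in> F. \<phi> f x \<in> C}"
        then obtain f where f: "f \<in> F" "\<phi> f x \<in> C" "h = g \<otimes> f" by auto
        then have "\<phi> h x = \<phi> g (\<phi> f x)" using composition_rule[OF x(1) gG, of f] F by auto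
        then show "h \<in> {f \<in> F. \<phi> f x \<in> \<phi> g ` C} \<union> (F' - F)" using f F(5)[OF g f(1)] by auto
      qed
    qed (use finF F in simp)
    also have "\<dots> \<le> card {f \<in> F. \<phi> f x \<in> \<phi> g ` C} + card (F' - F)" by (rule card_Un_le)
    finally have "real (card {f \<in> F. \<phi> f x \<in> C}) \<le> real (card {f \<in> F. \<phi> f x \<in> \<phi> g ` C}) + real (card (F' - F))"
      by linarith
    moreover have "real (card (F' - F)) = real (card F') - real (card F)"
      using F finF by (simp add: card_Diff_subset card_mono)
    ultimately have "real (card {f \<in> F. \<phi> f x \<in> C}) \<le> real (card {f \<in> F. \<phi> f x \<in> \<phi> g ` C}) + e * real (card F)"
      using F(6) by (simp add: algebra_simps)
    then show ?thesis using F0 by (simp add: m_def field_simps)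
  qed
  ultimately have "m \<in> almost_invariant A B K e" unfolding almost_invariant_def by blast
  then show ?thesis by blast
qed

text \<open>Without a window, the sets \<open>Q n\<close> of almost invariant contents with
  \<open>m B \<le> m A\<close> are nonempty, compact and decreasing. A common element is an
  invariant content, and the measure extending it contradicts \<open>less\<close>.\<close>

lemma window_exists:
  assumes G: "subexponential_group G" and X: "zero_dim_compact_metric_space X"
    and A: "clopen_in X A" and B: "clopen_in X B"
    and less: "\<And>\<mu>. invariant_borel_prob G X \<phi> \<mu> \<Longrightarrow> measure \<mu> A < measure \<mu> B"
  shows "\<exists>F. finite F \<and> F \<subseteq> carrier G \<and>
    (\<forall>x\<in>topspace X. card {f \<in> F. \<phi> f x \<in> A} < card {f \<in> F. \<phi> f x \<in> B})"
proof (rule ccontr)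
  assume "\<not> ?thesis"
  then have bad: "\<exists>x\<in>topspace X. card {f \<in> F. \<phi> f x \<in> B} \<le> card {f \<in> F. \<phi> f x \<in> A}"
    if "finite F" "F \<subseteq> carrier G" for F
    using that by (meson not_le)
  have cnt: "countable (carrier G)" using G by (simp add: subexponential_group_def)
  have ne: "carrier G \<noteq> {}" using one_closed by blast
  define K where "K n = from_nat_into (carrier G) ` {..n}" for n
  have K: "finite (K n)" "K n \<subseteq> carrier G" for n
    using from_nat_into[OF ne] by (auto simp: K_def)
  \<comment> \<open>\<open>K n\<close> exhausts the countable group while the tolerance tends to
    zero, so a content in every \<open>Q n\<close> is exactly invariant; \<open>Suc n\<close> keeps
    the tolerance positive at \<open>n = 0\<close>.\<close>
  define Q where "Q n = almost_invariant A B (K n) (1 / real (Suc n))" for n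
  have "(\<Inter>n. Q n) \<noteq> {}"
  proof (rule compact_closed_nest[OF compact_function_box])
    show "closed (Q n)" for n unfolding Q_def by (rule closed_almost_invariant)
    show "Q n \<subseteq> {m. \<forall>C. m C \<in> {0..1}}" for n by (auto simp: Q_def almost_invariant_def)
    show "Q n \<noteq> {}" for n unfolding Q_def by (rule almost_invariant_nonempty[OF G K _ bad]) auto
    show "decseq Q"
      unfolding Q_def
      by (intro decseq_SucI almost_invariant_mono) (auto simp: K_def frac_le)
  qed
  then obtain m where m: "\<And>n. m \<in> Q n" by blast
  have m': "\<And>C. 0 \<le> m C" "m (topspace X) = 1" "m B \<le> m A"
    "\<And>C D. clopen_in X C \<Longrightarrow> clopen_in X D \<Longrightarrow> C \<inter> D = {} \<Longrightarrow> m (C \<union> D) = m C + m D"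
    "\<And>n g C. g \<in> K n \<Longrightarrow> clopen_in X C \<Longrightarrow> m C \<le> m (\<phi> g ` C) + 1 / real (Suc n)"
    using m unfolding Q_def almost_invariant_def by auto
  have le: "m C \<le> m (\<phi> g ` C)" if g: "g \<in> carrier G" and C: "clopen_in X C" for g C
  proof -
    obtain i where i: "from_nat_into (carrier G) i = g" using from_nat_into_surj[OF cnt g] by blast
    have "eventually (\<lambda>n. m C \<le> m (\<phi> g ` C) + 1 / real (Suc n)) sequentially"
      unfolding eventually_sequentially
    proof (intro exI allI impI)
      fix n assume "i \<le> n"
      then have "g \<in> K n" using i by (auto simp: K_def)
      then show "m C \<le> m (\<phi> g ` C) + 1 / real (Suc n)" using m'(5) C by blast
    qed
    moreover have "(\<lambda>n. m (\<phi> g ` C) + 1 / real (Suc n)) \<longlonglongrightarrow> m (\<phi> g ` C) + 0"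
      by (intro tendsto_add tendsto_const LIMSEQ_Suc lim_1_over_n)
    ultimately show ?thesis
      using tendsto_lowerbound[of _ "m (\<phi> g ` C) + 0" sequentially "m C"] by simp
  qed
  have m_inv: "m (\<phi> g ` C) = m C" if g: "g \<in> carrier G" and C: "clopen_in X C" for g C
  proof (rule antisym)
    have "\<phi> (inv g) ` \<phi> g ` C = C"
      using act_inv[OF g] clopen_subset[OF C] by (force simp: image_image)
    then show "m (\<phi> g ` C) \<le> m C" using le[of "inv g" "\<phi> g ` C"] g clopen_image[OF g C] by simp
  qed (rule le[OF g C])
  obtain \<mu> where "invariant_borel_prob G X \<phi> \<mu>" "\<And>C. clopen_in X C \<Longrightarrow> measure \<mu> C = m C"
    using measure_from_clopen_content[of m, OF X m'(1,2,4) m_inv] by blast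
  then show False using less[of \<mu>] m'(3) A B by auto
qed

end


theorem theorem6p33:
  fixes G :: "('g, 'm) monoid_scheme"
  assumes "subexponential_group G"
  shows "comparison_property TYPE('x) G"
  unfolding comparison_property_def admits_comparison_def
proof (intro allI impI)
  fix X :: "'x topology" and \<phi> A B
  assume X: "zero_dim_compact_metric_space X \<and> action_by_homeomorphisms G X \<phi>"
    and AB: "clopen_in X A \<and> clopen_in X B \<and>
      (\<forall>\<mu>. invariant_borel_prob G X \<phi> \<mu> \<longrightarrow> measure \<mu> A < measure \<mu> B)"
  interpret clopen_action G X \<phi>
    using X by (auto simp: action_by_homeomorphisms_def clopen_action_def clopen_action_axioms_def)
  obtain F where F: "finite F" "F \<subseteq> carrier G"
    "\<And>x. x \<in> topspace X \<Longrightarrow> card {f \<in> F. \<phi> f x \<in> A} < card {f \<in> F. \<phi> f x \<in> B}"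
    using window_exists[OF assms, of A B] X AB by blast
  show "subequivalent G X \<phi> A B"
    using AB F by (intro subequivalent_if_window[of A B F] card_set_power_less_power[OF assms]) auto
qed

end
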